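(* Let $T$ be one of $[a,b]$ (with $a<b$ finite), $[a,\infty)$, or $(-\infty,\infty)$, and let $n>4$, where $n$ is even if $T=(-\infty,\infty)$. Let $K_n=\{c\in\mathbb{R}^{n+1}: c^\top\psi_n(t)\ge0\ \ \forall t\in T\}$ with $\psi_n(t)=(1,t,\ldots,t^n)^\top$, let $\Sigma$ be a positive definite $(n+1)\times(n+1)$ matrix, let $\widehat c\sim N_{n+1}(0,\Sigma)$, and put $\lambda_{01}=\Vert\Pi_{\Sigma^{-1}}(\widehat c|K_n)\Vert^2_{\Sigma^{-1}}$, $\lambda_{12}=\Vert\widehat c\Vert^2_{\Sigma^{-1}}-\lambda_{01}$. Let $w_0,\ldots,w_{n+1}$ be the weights in the representation $$P(\lambda_{01}\ge x,\ \lambda_{12}\ge y)=\sum_{i=0}^{n+1}w_i\,\bar G_i(x)\,\bar G_{n+1-i}(y),\qquad x,y\in\mathbb{R}.$$ Then for every $x\in\mathbb{R}$, $$\sum_{i=0}^{n+1}u_i\bar G_i(x)\le P(\lambda_{01}\ge x)\le\sum_{i=0}^{n+1}v_i\bar G_i(x),$$ $$\sum_{i=0}^{n+1}v_i\bar G_{n+1-i}(x)\le P(\lambda_{12}\ge x)\le\sum_{i=0}^{n+1}u_i\bar G_{n+1-i}(x),$$ where $$(u_0,\ldots,u_{n+1})=\begin{cases}\bigl(w_0,w_1,\frac12-w_0-w_{n+1},\frac12-w_1-w_n,\underbrace{0,\ldots,0}_{n-4},w_n,w_{n+1}\bigr)&(n\text{ odd}),\\ \bigl(w_0,w_1,\frac12-w_0-w_n,\frac12-w_1-w_{n+1},\underbrace{0,\ldots,0}_{n-4},w_n,w_{n+1}\bigr)&(n\text{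 even}),\end{cases}$$ $$(v_0,\ldots,v_{n+1})=\begin{cases}\bigl(w_0,w_1,\underbrace{0,\ldots,0}_{n-4},\frac12-w_1-w_n,\frac12-w_0-w_{n+1},w_n,w_{n+1}\bigr)&(n\text{ odd}),\\ \bigl(w_0,w_1,\underbrace{0,\ldots,0}_{n-4},\frac12-w_0-w_n,\frac12-w_1-w_{n+1},w_n,w_{n+1}\bigr)&(n\text{ even}).\end{cases}$$
   Context: For positive definite $Q$: $\Vert x\Vert_Q=\sqrt{x^\top Qx}$; $\Pi_Q(x|A)=\mathrm{argmin}_{y\in A}\Vert x-y\Vert_Q$ for a closed convex set $A$. $\bar G_i(x)=P(\chi^2_i\ge x)$ is the upper probability of the chi-square distribution with $i$ degrees of freedom; $\bar G_0(x)=1$ for $x\le0$ and $0$ for $x>0$. The existence of (unique) weights $w_i\ge0$ with $\sum_iw_i=1$ in the displayed mixture representation is a known general fact for closed convex cones. *)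

theory Defs
  imports "HOL-Probability.Probability"
begin

text \<open>
  Vectors in \<open>\<real>\<^sup>n\<^sup>+\<^sup>1\<close> have type \<open>real ^ 'm\<close>. The coordinates are numbered
  \<open>0, \<dots>, n\<close> by a bijection \<open>e\<close> from \<open>'m\<close> onto \<open>{0..n}\<close>, so that \<open>CARD('m) = n + 1\<close>
  and the coordinate \<open>k\<close> of a vector \<open>c\<close> is \<open>c $ i\<close> for the \<open>i\<close> with \<open>e i = k\<close>.
\<close>

definition pos_def :: "real ^ 'm ^ 'm \<Rightarrow> bool" where
  "pos_def Q \<longleftrightarrow> transpose Q = Q \<and> (\<forall>x. x \<noteq> 0 \<longrightarrow> x \<bullet> (Q *v x) > 0)"

definition qnorm :: "real ^ 'm ^ 'm \<Rightarrow> real ^ 'm \<Rightarrow> real" where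
  "qnorm Q x = sqrt (x \<bullet> (Q *v x))"

definition qproj :: "real ^ 'm ^ 'm \<Rightarrow> real ^ 'm \<Rightarrow> (real ^ 'm) set \<Rightarrow> real ^ 'm" where
  "qproj Q x A = arg_min_on (\<lambda>y. qnorm Q (x - y)) A"

definition monomial_vec :: "('m \<Rightarrow> nat) \<Rightarrow> real \<Rightarrow> real ^ 'm" where
  "monomial_vec e t = (\<chi> i. t ^ e i)"

definition nonneg_poly_cone :: "('m \<Rightarrow> nat) \<Rightarrow> real set \<Rightarrow> (real ^ 'm) set" where
  "nonneg_poly_cone e T = {c. \<forall>t\<in>T. c \<bullet> monomial_vec e t \<ge> 0}"

definition mvn_density :: "real ^ 'm \<Rightarrow> real ^ 'm ^ 'm \<Rightarrow> real ^ 'm \<Rightarrow> real" where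
  "mvn_density \<mu> \<Sigma> x =
     exp (- ((x - \<mu>) \<bullet> (matrix_inv \<Sigma> *v (x - \<mu>))) / 2) / sqrt ((2 * pi) ^ CARD('m) * det \<Sigma>)"

definition lambda01 :: "real ^ 'm ^ 'm \<Rightarrow> (real ^ 'm) set \<Rightarrow> real ^ 'm \<Rightarrow> real" where
  "lambda01 \<Sigma> K c = (qnorm (matrix_inv \<Sigma>) (qproj (matrix_inv \<Sigma>) c K))\<^sup>2"

definition lambda12 :: "real ^ 'm ^ 'm \<Rightarrow> (real ^ 'm) set \<Rightarrow> real ^ 'm \<Rightarrow> real" where
  "lambda12 \<Sigma> K c = (qnorm (matrix_inv \<Sigma>) c)\<^sup>2 - lambda01 \<Sigma> K c"

text \<open>The chi-square law: the sum of squares of \<open>k\<close> independent standard normals.\<close>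

definition chi_square :: "nat \<Rightarrow> real measure" where
  "chi_square k =
     distr (Pi\<^sub>M {..<k} (\<lambda>_. density lborel (\<lambda>t. ennreal (std_normal_density t)))) borel
       (\<lambda>z. \<Sum>j<k. (z j)\<^sup>2)"

definition chi_square_upper :: "nat \<Rightarrow> real \<Rightarrow> real" where
  "chi_square_upper k x =
     (if k = 0 then (if x \<le> 0 then 1 else 0) else measure (chi_square k) {x..})"

text \<open>Both lists have length \<open>n + 2\<close> when \<open>n > 4\<close>; entry \<open>i\<close> is obtained by \<open>!\<close>.\<close>

definition u_weights :: "nat \<Rightarrow> (nat \<Rightarrow> real) \<Rightarrow> real list" where
  "u_weights n w =
     (if odd n
      then [w 0, w 1, 1/2 - w 0 - w (n + 1), 1/2 - w 1 - w n]
             @ replicate (n - 4) 0 @ [w n, w (n + 1)]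
      else [w 0, w 1, 1/2 - w 0 - w n, 1/2 - w 1 - w (n + 1)]
             @ replicate (n - 4) 0 @ [w n, w (n + 1)])"

definition v_weights :: "nat \<Rightarrow> (nat \<Rightarrow> real) \<Rightarrow> real list" where
  "v_weights n w =
     (if odd n
      then [w 0, w 1] @ replicate (n - 4) 0
             @ [1/2 - w 1 - w n, 1/2 - w 0 - w (n + 1), w n, w (n + 1)]
      else [w 0, w 1] @ replicate (n - 4) 0
             @ [1/2 - w 0 - w n, 1/2 - w 1 - w (n + 1), w n, w (n + 1)])"

end

theory Submission
  imports Defs
begin

text \<open>
  Since \<open>\<chi>\<^sup>2\<^sub>i\<close> increases stochastically with \<open>i\<close>, the bounds follow by moving the middle weights to
  the ends, separately for even and odd indices, once both parity classes are known to have total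
  weight \<open>1/2\<close>. This is the Gauss-Bonnet identity \<open>\<Sum>\<^sub>i (-1)\<^sup>i w\<^sub>i = 0\<close> for a closed convex cone that is not a
  linear subspace.

  In coordinates where \<open>\<Sigma>\<close> is the identity, let \<open>p\<close> be the projection onto the cone, \<open>q = x - p\<close> the
  projection onto the polar cone, \<open>N = n + 1\<close> the dimension, and \<open>\<Phi>\<^sub>t(x) = p + t q\<close>. For
  \<open>0 < t < 1\<close> the Laplace transform of \<open>\<lambda>\<^sub>1\<^sub>2\<close> at \<open>(1/t\<^sup>2 - 1)/2\<close> is \<open>\<Sum>\<^sub>i w\<^sub>i t\<^sup>N\<^sup>-\<^sup>i\<close>; it is also a constant
  times the volume of \<open>\<Phi>\<^sub>t(B)\<close>, where \<open>B\<close> is the unit ball. For a polyhedral cone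
  this volume is the integral over \<open>B\<close> of the Jacobian of \<open>\<Phi>\<^sub>t\<close>, a polynomial in \<open>t\<close>, and its value at
  \<open>t = -1\<close> vanishes: \<open>\<Phi>\<^sub>-\<^sub>1\<close> maps spheres to hemispheres, so inside \<open>B\<close> it can be replaced
  by a map \<open>H\<close> into the unit sphere, whose Jacobian is zero. The replacement is harmless by an argument of
  Milnor and Rogers: for \<open>t\<close> close to 1 the maps \<open>\<Phi>\<^sub>t\<close> and \<open>((1 + t) x + (1 - t) H(x)) / 2\<close> are bijections that agree
  outside \<open>B\<close>, so they map \<open>B\<close> onto the same set, and the two polynomials coincide.
  A general cone is a decreasing limit of polyhedral ones; the limit is taken at \<open>N + 1\<close> values
  of \<open>t\<close>, and Lagrange interpolation recovers the value at \<open>-1\<close>.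
\<close>

section \<open>Projection onto a closed convex cone\<close>

locale closed_convex_cone =
  fixes K :: "'a::euclidean_space set"
  assumes closed: "closed K" and convex: "convex K" and cone: "cone K" and nonempty: "K \<noteq> {}"
begin

definition proj :: "'a \<Rightarrow> 'a" where
  "proj = closest_point K"

text \<open>The map \<Phi> of the overview; \<open>stretch (-1)\<close> is the reflection
  \<open>2 proj - id\<close>.\<close>

definition stretch :: "real \<Rightarrow> 'a \<Rightarrow> 'a" where
  "stretch t x = proj x + t *\<^sub>R (x - proj x)"

lemma proj_in: "proj x \<in> K"
  unfolding proj_def using closed nonempty by (rule closest_point_in_set)

lemma scale_in: "k \<in> K \<Longrightarrow> c \<ge> 0 \<Longrightarrow> c *\<^sub>R k \<in> K"
  using cone by (simp add: cone_def)

lemma add_in: "k \<in> K \<Longrightarrow> l \<in> K \<Longrightarrow> k + l \<in> K"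
  using convex cone convex_cone by blast

lemma proj_dot: "k \<in> K \<Longrightarrow> (x - proj x) \<bullet> (k - proj x) \<le> 0"
  unfolding proj_def using convex closed by (rule closest_point_dot)

text \<open>Both \<open>2 * proj x\<close> and \<open>0\<close> lie on the ray of \<open>K\<close>
  through \<open>proj x\<close>; testing the variational inequality at them gives the two opposite
  signs.\<close>

lemma proj_orth: "(x - proj x) \<bullet> proj x = 0"
proof -
  have "(x - proj x) \<bullet> (2 *\<^sub>R proj x - proj x) \<le> 0"
    by (intro proj_dot scale_in proj_in) simp
  moreover have "(x - proj x) \<bullet> (0 *\<^sub>R proj x - proj x) \<le> 0"
    by (intro proj_dot scale_in proj_in) simp
  ultimately show ?thesis
    by (simp add: inner_diff_right scaleR_2 inner_add_right)
qed

lemma proj_polar: "k \<in> K \<Longrightarrow> (x - proj x) \<bullet> k \<le> 0"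
  using proj_dot[of k x] proj_orth[of x] by (simp add: inner_diff_right)

text \<open>Moreau's characterisation: expanding the squared distance from \<open>x\<close> to
  \<open>k\<close> around \<open>y\<close>, the cross term reduces to
  \<open>- 2 * ((x - y) \<bullet> k)\<close>, which is nonnegative. It identifies projections after
  stretching and scaling, and on the linear pieces of a polyhedral cone.\<close>

lemma proj_eqI:
  assumes y: "y \<in> K" and orth: "(x - y) \<bullet> y = 0" and polar: "\<And>k. k \<in> K \<Longrightarrow> (x - y) \<bullet> k \<le> 0"
  shows "proj x = y"
proof -
  have "dist x y \<le> dist x k" if "k \<in> K" for k
  proof -
    have "(norm (x - k))\<^sup>2 = (norm (x - y))\<^sup>2 + (norm (y - k))\<^sup>2 - 2 * ((x - y) \<bullet> k)"
      using orth
      by (simp add: power2_norm_eq_inner inner_diff_left inner_diff_right inner_commute)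
    then have "(norm (x - y))\<^sup>2 \<le> (norm (x - k))\<^sup>2"
      using polar[OF that] by (smt (verit) zero_le_power2)
    then show ?thesis by (simp add: dist_norm)
  qed
  then show ?thesis
    unfolding proj_def by (metis closest_point_unique closed convex y)
qed

text \<open>For \<open>t \<ge> 0\<close> the vector \<open>t *\<^sub>R (x - proj x)\<close> stays
  polar to \<open>K\<close> and orthogonal to \<open>proj x\<close>. Hence
  \<open>stretch (1 / t)\<close> inverts \<open>stretch t\<close> for \<open>t > 0\<close>.\<close>

lemma proj_stretch: "t \<ge> 0 \<Longrightarrow> proj (stretch t x) = proj x"
  by (rule proj_eqI)
    (auto simp: stretch_def proj_in proj_orth mult_nonneg_nonpos proj_polar)

lemma stretch_stretch: "s \<ge> 0 \<Longrightarrow> stretch t (stretch s x) = stretch (t * s) x"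
  using proj_stretch[of s x] by (simp add: stretch_def)

lemma stretch_1 [simp]: "stretch 1 x = x"
  by (simp add: stretch_def)

lemma norm_stretch: "(norm (stretch t x))\<^sup>2 = (norm (proj x))\<^sup>2 + t\<^sup>2 * (norm (x - proj x))\<^sup>2"
proof -
  have "(norm (stretch t x))\<^sup>2 = proj x \<bullet> proj x + 2 * t * ((x - proj x) \<bullet> proj x)
      + t\<^sup>2 * ((x - proj x) \<bullet> (x - proj x))"
    unfolding stretch_def power2_norm_eq_inner
    by (simp only: inner_add_left inner_add_right inner_scaleR_left inner_scaleR_right
        inner_commute[of "proj x" "x - proj x"]) (simp add: power2_eq_square algebra_simps)
  then show ?thesis by (simp add: proj_orth power2_norm_eq_inner)
qed

lemma norm_stretch_minus_1: "norm (stretch (-1) x) = norm x"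
proof -
  have "(norm (stretch (-1) x))\<^sup>2 = (norm (stretch 1 x))\<^sup>2"
    by (simp only: norm_stretch) simp
  then show ?thesis by simp
qed

lemma pythagoras: "(norm x)\<^sup>2 = (norm (proj x))\<^sup>2 + (norm (x - proj x))\<^sup>2"
  using norm_stretch[of 1 x] by simp

lemma proj_scale: "c \<ge> 0 \<Longrightarrow> proj (c *\<^sub>R x) = c *\<^sub>R proj x"
  by (rule proj_eqI)
    (auto simp: proj_in scale_in proj_orth mult_nonneg_nonpos proj_polar simp flip: scaleR_diff_right)

lemma stretch_scale: "c \<ge> 0 \<Longrightarrow> stretch t (c *\<^sub>R x) = c *\<^sub>R stretch t x"
  by (simp add: stretch_def proj_scale algebra_simps)

lemma proj_firmly_nonexpansive:
  "(norm (proj x - proj y))\<^sup>2 \<le> (proj x - proj y) \<bullet> (x - y)"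
  using proj_dot[OF proj_in[of y], of x] proj_dot[OF proj_in[of x], of y]
  by (simp add: power2_norm_eq_inner inner_diff_left inner_diff_right inner_commute)

text \<open>For the reflection \<open>2 proj - id\<close>, expanding the square turns
  nonexpansiveness into the firm nonexpansiveness of \<open>proj\<close>.\<close>

lemma stretch_minus_1_nonexpansive: "norm (stretch (-1) x - stretch (-1) y) \<le> norm (x - y)"
proof -
  have *: "stretch (-1) x - stretch (-1) y = 2 *\<^sub>R (proj x - proj y) - (x - y)"
    by (simp add: stretch_def algebra_simps scaleR_2)
  have "(norm (stretch (-1) x - stretch (-1) y))\<^sup>2 = 4 * (norm (proj x - proj y))\<^sup>2
      - 4 * ((proj x - proj y) \<bullet> (x - y)) + (norm (x - y))\<^sup>2"
    unfolding * power2_norm_eq_inner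
    by (simp only: inner_diff_left[of "2 *\<^sub>R (proj x - proj y)"]
        inner_diff_right[of _ "2 *\<^sub>R (proj x - proj y)"]
        inner_scaleR_left inner_scaleR_right inner_commute[of "x - y" "proj x - proj y"]) simp
  then have "(norm (stretch (-1) x - stretch (-1) y))\<^sup>2 \<le> (norm (x - y))\<^sup>2"
    using proj_firmly_nonexpansive[of x y] by linarith
  then show ?thesis by simp
qed

lemma continuous_on_proj: "continuous_on S proj"
  unfolding proj_def by (intro continuous_on_closest_point convex closed nonempty)

lemma continuous_on_stretch: "continuous_on S (stretch t)"
  unfolding stretch_def by (intro continuous_intros continuous_on_proj)

text \<open>A closed convex cone that is not a linear subspace meets its dual cone in a nonzero
  vector. Such a vector is nonnegative on \<open>proj x\<close> and nonpositive on
  \<open>x - proj x\<close>.\<close>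

lemma stretch_halfspace:
  assumes k: "k \<in> K" "- k \<notin> K"
  obtains v where "norm v = 1" "\<And>x. v \<bullet> stretch (-1) x \<ge> 0"
proof -
  \<comment> \<open>Minus the polar component of \<open>- k\<close>, hence in the dual cone; as a
    sum of two elements of \<open>K\<close> it also lies in \<open>K\<close>.\<close>
  define u where "u = k + proj (- k)"
  have "u \<noteq> 0"
  proof
    assume "u = 0"
    then have "- k = proj (- k)" by (simp add: u_def add_eq_0_iff)
    with proj_in[of "- k"] k(2) show False by simp
  qed
  have u_in: "u \<in> K" unfolding u_def using k proj_in add_in by blast
  have u_dual: "u \<bullet> l \<ge> 0" if "l \<in> K" for l
    using proj_polar[OF that, of "- k"] by (simp add: u_def inner_diff_left inner_add_left)
  have nonneg: "u \<bullet> stretch (-1) x \<ge> 0" for x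
    using u_dual[OF proj_in[of x]] proj_polar[OF u_in, of x]
    by (simp add: stretch_def inner_add_right inner_diff_left inner_diff_right inner_commute)
  show ?thesis
    by (rule that[of "u /\<^sub>R norm u"]) (use nonneg \<open>u \<noteq> 0\<close> in auto)
qed

end

section \<open>Volumes of images as polynomials in a parameter\<close>

lemma poly_lagrange_interpolation:
  fixes p :: "'a::field_char_0 poly"
  assumes S: "finite S" and deg: "degree p < card S"
  shows "poly p x = (\<Sum>t\<in>S. (\<Prod>s\<in>S - {t}. (x - s) / (t - s)) * poly p t)"
proof -
  define q where "q = (\<Sum>t\<in>S. smult (poly p t) (\<Prod>s\<in>S - {t}. smult (1 / (t - s)) [:- s, 1:]))"
  have poly_q: "poly q x = (\<Sum>t\<in>S. (\<Prod>s\<in>S - {t}. (x - s) / (t - s)) * poly p t)" for x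
    unfolding q_def poly_sum poly_smult poly_prod
    by (intro sum.cong refl) (simp add: mult.commute[of "poly p _"])
  have "degree q \<le> card S - 1"
    unfolding q_def
  proof (rule degree_sum_le[OF S])
    fix t assume t: "t \<in> S"
    have "degree (\<Prod>s\<in>S - {t}. smult (1 / (t - s)) [:- s, 1:]) \<le> (\<Sum>s\<in>S - {t}. 1)"
      using S by (intro degree_prod_sum_le[THEN order_trans] sum_mono) auto
    also have "\<dots> = card S - 1" using S t by simp
    finally show "degree (smult (poly p t) (\<Prod>s\<in>S - {t}. smult (1 / (t - s)) [:- s, 1:])) \<le> card S - 1"
      using degree_smult_le le_trans by blast
  qed
  then have deg_q: "degree q < card S" using deg by linarith
  have "poly q t = poly p t" if t: "t \<in> S" for t
  proof -
    have "poly q t = (\<Sum>r\<in>S. if r = t then poly p t else 0)"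
      unfolding poly_q
    proof (rule sum.cong[OF refl])
      fix r assume r: "r \<in> S"
      show "(\<Prod>s\<in>S - {r}. (t - s) / (r - s)) * poly p r = (if r = t then poly p t else 0)"
      proof (cases "r = t")
        case True
        have "(\<Prod>s\<in>S - {t}. (t - s) / (t - s)) = (\<Prod>s\<in>S - {t}. 1)"
          by (rule prod.cong) auto
        then show ?thesis using True by simp
      next
        case False
        then have "(\<Prod>s\<in>S - {r}. (t - s) / (r - s)) = 0"
          using S t by (intro prod_zero) auto
        then show ?thesis using False by simp
      qed
    qed
    then show ?thesis using S t by simp
  qed
  then have "p = q" using deg deg_q by (intro poly_eqI_degree[of S]) auto
  then show ?thesis using poly_q[of x] by simp
qed

section \<open>Blending a Lipschitz map with the identity\<close>

text \<open>Affine in \<open>t\<close>, the identity at 1 and \<open>H\<close> at -1. For the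
  reflection \<open>H = stretch (-1)\<close> of a cone it is \<open>stretch t\<close>.\<close>

definition blend :: "real \<Rightarrow> ('a::real_vector \<Rightarrow> 'a) \<Rightarrow> 'a \<Rightarrow> 'a" where
  "blend t H x = ((1 + t) / 2) *\<^sub>R x + ((1 - t) / 2) *\<^sub>R H x"

lemma linear_blend: "linear f \<Longrightarrow> linear (blend t f)"
  unfolding blend_def
  by (intro linear_compose_add linear_compose_scale_right linear_ident) (auto simp: linear_iff algebra_simps)

text \<open>The matrix entries are polynomials \<open>c i j\<close> of degree at most 1 in
  \<open>t\<close>, and every term of the Leibniz formula is a product of \<open>CARD('n)\<close> of
  them.\<close>

lemma det_blend_poly:
  fixes f :: "real^'n \<Rightarrow> real^'n"
  obtains p where "degree p \<le> CARD('n)" "\<And>t. det (matrix (blend t f)) = poly p t"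
proof -
  define c where "c i j = [:((axis j 1 :: real^'n) $ i + f (axis j 1) $ i) / 2,
    ((axis j 1 :: real^'n) $ i - f (axis j 1) $ i) / 2:]" for i j
  define p where "p = (\<Sum>\<sigma> | \<sigma> permutes (UNIV :: 'n set). of_int (sign \<sigma>) * (\<Prod>i\<in>UNIV. c i (\<sigma> i)))"
  have entry: "matrix (blend t f) $ i $ j = poly (c i j) t" for t i j
    by (simp add: matrix_def blend_def c_def field_simps)
  have "det (matrix (blend t f)) = poly p t" for t
    by (simp add: det_def p_def entry poly_sum poly_prod)
  moreover have "degree p \<le> CARD('n)"
    unfolding p_def
  proof (rule degree_sum_le)
    fix \<sigma> :: "'n \<Rightarrow> 'n"
    have "degree (\<Prod>i\<in>UNIV. c i (\<sigma> i)) \<le> (\<Sum>i\<in>(UNIV :: 'n set). 1)"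
      by (intro degree_prod_sum_le[THEN order_trans] sum_mono) (auto simp: c_def)
    then have "degree (\<Prod>i\<in>UNIV. c i (\<sigma> i)) \<le> CARD('n)" by simp
    then show "degree (of_int (sign \<sigma>) * (\<Prod>i\<in>UNIV. c i (\<sigma> i))) \<le> CARD('n)"
      by (simp add: sign_def)
  qed (simp add: finite_permutations)
  ultimately show ?thesis using that by blast
qed

text \<open>The value at -1 of the Lagrange basis polynomial belonging to the node
  \<open>t\<close>.\<close>

definition lagrange_weight :: "real set \<Rightarrow> real \<Rightarrow> real" where
  "lagrange_weight S t = (\<Prod>s\<in>S - {t}. (- 1 - s) / (t - s))"

lemma poly_minus_1_lagrange:
  assumes "finite S" "degree p < card S"
  shows "poly p (-1) = (\<Sum>t\<in>S. lagrange_weight S t * poly p t)"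
  unfolding lagrange_weight_def using poly_lagrange_interpolation[OF assms, of "-1"] .

text \<open>At -1 the blend is \<open>f\<close> itself, whose determinant may have any sign. It gets
  expressed through nodes at which the determinant will be positive and measure volumes.\<close>

lemma det_minus_1_lagrange:
  fixes f :: "real^'n \<Rightarrow> real^'n"
  assumes "finite S" "CARD('n) < card S"
  shows "det (matrix f) = (\<Sum>t\<in>S. lagrange_weight S t * det (matrix (blend t f)))"
proof -
  obtain p where p: "degree p \<le> CARD('n)" "\<And>t. det (matrix (blend t f)) = poly p t"
    using det_blend_poly by blast
  have "blend (-1) f = f" by (simp add: fun_eq_iff blend_def)
  then have "det (matrix f) = poly p (-1)" by (simp flip: p(2))
  then show ?thesis
    using poly_minus_1_lagrange[OF assms(1) le_less_trans[OF p(1) assms(2)]] by (simp add: p(2))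
qed

lemma has_derivative_lipschitz_bound:
  fixes f :: "'a::real_normed_vector \<Rightarrow> 'b::real_normed_vector"
  assumes f: "(f has_derivative f') (at x)" and lip: "\<And>x y. norm (f x - f y) \<le> L * norm (x - y)"
  shows "norm (f' h) \<le> L * norm h"
proof (rule field_le_epsilon)
  fix e :: real assume e: "e > 0"
  define e' where "e' = e / (norm h + 1)"
  have e': "e' > 0" using e by (simp add: e'_def add_nonneg_pos)
  then obtain d where d: "d > 0" "\<And>y. norm (y - x) < d \<Longrightarrow> norm (f y - f x - f' (y - x)) \<le> e' * norm (y - x)"
    using f unfolding has_derivative_at_alt by blast
  define s where "s = d / (2 * (norm h + 1))"
  have nh: "norm h + 1 > 0" by (simp add: add_nonneg_pos)
  have s: "s > 0" using d(1) nh by (simp add: s_def)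
  have "s * norm h < d"
  proof -
    have "s * norm h \<le> s * (norm h + 1)" using s by simp
    also have "\<dots> = d / 2" using nh by (simp add: s_def field_simps)
    finally show ?thesis using d(1) by simp
  qed
  then have "norm (f (x + s *\<^sub>R h) - f x - f' (s *\<^sub>R h)) \<le> e' * (s * norm h)"
    using d(2)[of "x + s *\<^sub>R h"] s by simp
  moreover have "norm (f (x + s *\<^sub>R h) - f x) \<le> L * (s * norm h)"
    using lip[of "x + s *\<^sub>R h" x] s by simp
  moreover have "norm (f' (s *\<^sub>R h)) = s * norm (f' h)"
    using linear_scale[OF has_derivative_linear[OF f]] s by simp
  ultimately have "s * norm (f' h) \<le> L * (s * norm h) + e' * (s * norm h)"
    by (smt (verit) norm_triangle_ineq2 norm_minus_commute)
  then have "s * norm (f' h) \<le> s * (L * norm h + e' * norm h)" by (simp add: algebra_simps)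
  then have "norm (f' h) \<le> L * norm h + e' * norm h" using s by simp
  also have "e' * norm h \<le> e' * (norm h + 1)" using e' by simp
  also have "\<dots> = e" using nh by (simp add: e'_def)
  finally show "norm (f' h) \<le> L * norm h + e" by simp
qed

text \<open>Under \<open>(1 - t) * L < 1 + t\<close> the identity part dominates; this means
  \<open>t > 0\<close> for \<open>L = 1\<close> and \<open>t > 4/5\<close> for \<open>L = 9\<close>.
  The determinant is 1 at parameter 1, so a nonpositive value at \<open>t\<close> would force a zero
  in between, and a kernel vector there contradicts the domination.\<close>

lemma det_blend_pos:
  fixes f :: "real^'n \<Rightarrow> real^'n"
  assumes f: "linear f" and bound: "\<And>h. norm (f h) \<le> L * norm h" and "L \<ge> 0"
    and t: "t \<le> 1" "(1 - t) * L < 1 + t"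
  shows "det (matrix (blend t f)) > 0"
proof (rule ccontr)
  assume neg: "\<not> ?thesis"
  have t1: "1 + t > 0" using t \<open>L \<ge> 0\<close> by (smt (verit) mult_nonneg_nonneg)
  obtain p where p: "\<And>t. det (matrix (blend t f)) = poly p t"
    using det_blend_poly by blast
  have "blend 1 f = id" by (simp add: fun_eq_iff blend_def)
  then have "poly p 1 = 1" by (simp flip: p add: matrix_id)
  moreover have "poly p t \<le> 0" using neg p by simp
  ultimately obtain s where s: "t \<le> s" "s \<le> 1" "poly p s = 0"
    using IVT'[of "poly p" t 0 1, OF _ _ _ continuous_on_poly[OF continuous_on_id]] t by auto
  have lin: "linear (blend s f)" using f by (rule linear_blend)
  obtain h where h: "h \<noteq> 0" "blend s f h = 0"
    using s(3) p det_nz_iff_inj[OF lin] linear_injective_0[OF lin] by auto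
  from h(2) have "((1 + s) / 2) *\<^sub>R h = - (((1 - s) / 2) *\<^sub>R f h)"
    by (simp add: blend_def add_eq_0_iff2)
  then have "norm (((1 + s) / 2) *\<^sub>R h) = norm (((1 - s) / 2) *\<^sub>R f h)" by (metis norm_minus_cancel)
  then have "(1 + s) * norm h = (1 - s) * norm (f h)" using s t1 by simp
  also have "\<dots> \<le> (1 - s) * (L * norm h)" using s bound by (intro mult_left_mono) auto
  finally have "(1 + s) * norm h \<le> ((1 - s) * L) * norm h" by simp
  then have "1 + s \<le> (1 - s) * L" using h(1) by simp
  also have "\<dots> \<le> (1 - t) * L" using s \<open>L \<ge> 0\<close> by (intro mult_right_mono) auto
  finally show False using t s by simp
qed

lemma blend_inj_bound:
  fixes H :: "'a::real_normed_vector \<Rightarrow> 'a"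
  assumes lip: "\<And>x y. norm (H x - H y) \<le> L * norm (x - y)" and t: "t \<le> 1" "(1 - t) * L < 1 + t"
    and eq: "blend t H x = blend t H y"
  shows "x = y"
proof (rule ccontr)
  assume ne: "x \<noteq> y"
  have "L \<ge> 0" using lip[of x y] ne by (smt (verit) norm_ge_zero zero_less_norm_iff mult_neg_pos right_minus_eq)
  then have t1: "1 + t > 0" using t by (smt (verit) mult_nonneg_nonneg)
  have "((1 + t) / 2) *\<^sub>R (x - y) = ((1 - t) / 2) *\<^sub>R (H y - H x)"
    using eq by (simp add: blend_def algebra_simps)
  then have "norm (((1 + t) / 2) *\<^sub>R (x - y)) = norm (((1 - t) / 2) *\<^sub>R (H y - H x))" by simp
  then have "(1 + t) * norm (x - y) = (1 - t) * norm (H y - H x)" using t t1 by simp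
  also have "\<dots> \<le> (1 - t) * (L * norm (x - y))" using t lip[of y x] by (intro mult_left_mono) (auto simp: norm_minus_commute)
  finally have "(1 + t) * norm (x - y) \<le> ((1 - t) * L) * norm (x - y)" by simp
  then show False using ne t by simp
qed

text \<open>Solving \<open>blend t H x = y\<close> for its identity part gives a fixed point
  equation with contraction constant \<open>(1 - t) * L / (1 + t)\<close>.\<close>

lemma blend_surj:
  fixes H :: "'a::banach \<Rightarrow> 'a"
  assumes lip: "\<And>x y. norm (H x - H y) \<le> L * norm (x - y)" and "L \<ge> 0" and t: "t \<le> 1" "(1 - t) * L < 1 + t"
  shows "\<exists>x. blend t H x = y"
proof -
  define a b where "a = (1 + t) / 2" and "b = (1 - t) / 2"
  have t1: "1 + t > 0" using t \<open>L \<ge> 0\<close> by (smt (verit) mult_nonneg_nonneg)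
  then have a: "a > 0" and b: "b \<ge> 0" using t by (auto simp: a_def b_def)
  define f where "f x = (1 / a) *\<^sub>R (y - b *\<^sub>R H x)" for x
  have "\<exists>!x. f x = x"
  proof (rule banach_fix_type)
    show "0 \<le> b * L / a" using a b \<open>L \<ge> 0\<close> by simp
    show "b * L / a < 1" using t a by (simp add: a_def b_def)
    show "\<forall>x z. dist (f x) (f z) \<le> b * L / a * dist x z"
    proof (intro allI)
      fix x z
      have "f x - f z = (b / a) *\<^sub>R (H z - H x)" by (simp add: f_def algebra_simps)
      then have "norm (f x - f z) = (b / a) * norm (H z - H x)" using a b by simp
      also have "\<dots> \<le> (b / a) * (L * norm (x - z))"
        using a b lip[of z x] by (intro mult_left_mono) (auto simp: norm_minus_commute)
      finally show "dist (f x) (f z) \<le> b * L / a * dist x z" by (simp add: dist_norm)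
    qed
  qed
  then obtain x where "f x = x" by blast
  then have "a *\<^sub>R x = y - b *\<^sub>R H x" using a by (metis f_def scaleR_one scaleR_scaleR nonzero_eq_divide_eq less_irrefl mult.commute)
  then have "blend t H x = y" by (simp add: blend_def a_def b_def)
  then show ?thesis ..
qed

lemma blend_image_volume:
  fixes H :: "real^'n::{finite,wellorder} \<Rightarrow> real^'n::_"
  assumes lip: "\<And>x y. norm (H x - H y) \<le> L * norm (x - y)" and L: "L \<ge> 0"
    and t: "t \<le> 1" "(1 - t) * L < 1 + t"
    and N: "negligible N" and H': "\<And>x. x \<in> ball 0 1 - N \<Longrightarrow> (H has_derivative H' x) (at x)"
  shows "((\<lambda>x. det (matrix (blend t (H' x)))) has_integral
    measure lebesgue (blend t H ` ball 0 1)) (ball 0 1 - N)"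
proof -
  let ?h = "blend t H" and ?S = "ball 0 1 - N"
  have t1: "1 + t > 0" using t L by (smt (verit) mult_nonneg_nonneg)
  have inj: "inj ?h" using blend_inj_bound[OF lip t] by (auto intro: injI)
  have h_lip: "norm (?h x - ?h y) \<le> (1 + t + L * (1 - t)) * norm (x - y)" for x y
  proof -
    have "?h x - ?h y = ((1 + t) / 2) *\<^sub>R (x - y) + ((1 - t) / 2) *\<^sub>R (H x - H y)"
      by (simp add: blend_def algebra_simps)
    then have "norm (?h x - ?h y) \<le> ((1 + t) / 2) * norm (x - y) + ((1 - t) / 2) * norm (H x - H y)"
      using t t1 norm_triangle_ineq[of "((1 + t) / 2) *\<^sub>R (x - y)" "((1 - t) / 2) *\<^sub>R (H x - H y)"] by simp
    also have "\<dots> \<le> ((1 + t) / 2) * norm (x - y) + ((1 - t) / 2) * (L * norm (x - y))"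
      using t lip[of x y] by (intro add_mono mult_left_mono order_refl) simp_all
    also have "\<dots> = ((1 + t + L * (1 - t)) / 2) * norm (x - y)"
      by (simp add: algebra_simps add_divide_distrib diff_divide_distrib)
    also have "\<dots> \<le> (1 + t + L * (1 - t)) * norm (x - y)"
      using t t1 L by (intro mult_right_mono) auto
    finally show ?thesis .
  qed
  have cont: "continuous_on UNIV ?h"
  proof -
    have "(1 + t + L * (1 - t))-lipschitz_on UNIV ?h"
      unfolding lipschitz_on_def dist_norm using h_lip t t1 L by simp
    then show ?thesis by (rule lipschitz_on_continuous_on)
  qed
  \<comment> \<open>The image of the ball is open by invariance of domain, which settles its
    measurability.\<close>
  have "open (?h ` ball 0 1)"
    using inj cont by (intro invariance_of_domain continuous_on_subset[OF cont])
      (auto intro: inj_on_subset)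
  moreover have "bounded (?h ` ball 0 1)"
    by (rule bounded_subset[OF compact_imp_bounded[OF compact_continuous_image[of "cball 0 1" ?h]]])
      (auto intro: continuous_on_subset[OF cont])
  ultimately have lm: "?h ` ball 0 1 \<in> lmeasurable"
    by (simp add: bounded_set_imp_lmeasurable borel_open)
  have "negligible (?h ` N)"
    using N h_lip by (intro negligible_locally_Lipschitz_image) auto
  then have neg: "negligible ((?h ` ball 0 1 - ?h ` ?S) \<union> (?h ` ?S - ?h ` ball 0 1))"
    by (rule negligible_subset) auto
  have lmS: "?h ` ?S \<in> lmeasurable" by (rule lmeasurable_negligible_symdiff[OF lm neg])
  have meas: "measure lebesgue (?h ` ?S) = measure lebesgue (?h ` ball 0 1)"
    by (rule measure_negligible_symdiff[OF lm neg])
  have S: "?S \<in> sets lebesgue"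
    using N by (auto simp: negligible_iff_null_sets)
  have der: "(?h has_derivative blend t (H' x)) (at x within ?S)" if "x \<in> ?S" for x
    unfolding blend_def[abs_def]
    by (intro has_derivative_add has_derivative_scaleR_right has_derivative_ident
        has_derivative_at_withinI[OF H'[OF that]])
  have injS: "inj_on ?h ?S" using inj by (rule inj_on_subset) auto
  have pos: "det (matrix (blend t (H' x))) > 0" if "x \<in> ?S" for x
    using det_blend_pos[of "H' x" L t, OF has_derivative_linear[OF H'[OF that]]]
      has_derivative_lipschitz_bound[OF H'[OF that] lip] L t by simp
  have int: "(\<lambda>x. \<bar>det (matrix (blend t (H' x)))\<bar>) integrable_on ?S"
    using measurable_differentiable_image_eq[OF S der injS] lmS by blast
  then have "((\<lambda>x. \<bar>det (matrix (blend t (H' x)))\<bar>) has_integral measure lebesgue (?h ` ?S)) ?S"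
    using measure_differentiable_image_eq[OF S der injS] by (simp add: has_integral_integral)
  then show ?thesis
    unfolding meas by (rule has_integral_eq[rotated]) (simp add: pos less_imp_le)
qed

text \<open>The integrand does not involve \<open>S\<close>: every admissible set of nodes yields
  the same combination of volumes, the integral of the signed Jacobian of \<open>H\<close>. This
  lets nodes be exchanged later.\<close>

lemma sum_lagrange_volume:
  fixes H :: "real^'n::{finite,wellorder} \<Rightarrow> real^'n::_"
  assumes lip: "\<And>x y. norm (H x - H y) \<le> L * norm (x - y)" and L: "L \<ge> 0"
    and S: "finite S" "CARD('n) < card S" "\<And>t. t \<in> S \<Longrightarrow> t \<le> 1 \<and> (1 - t) * L < 1 + t"
    and N: "negligible N" and H': "\<And>x. x \<in> ball 0 1 - N \<Longrightarrow> (H has_derivative H' x) (at x)"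
  shows "((\<lambda>x. det (matrix (H' x))) has_integral
    (\<Sum>t\<in>S. lagrange_weight S t * measure lebesgue (blend t H ` ball 0 1))) (ball 0 1 - N)"
proof (rule has_integral_eq)
  show "((\<lambda>x. \<Sum>t\<in>S. lagrange_weight S t * det (matrix (blend t (H' x)))) has_integral
    (\<Sum>t\<in>S. lagrange_weight S t * measure lebesgue (blend t H ` ball 0 1))) (ball 0 1 - N)"
    using S(3) by (intro has_integral_sum has_integral_mult_right S(1) blend_image_volume[OF lip L _ _ N H']) simp_all
  show "(\<Sum>t\<in>S. lagrange_weight S t * det (matrix (blend t (H' x)))) = det (matrix (H' x))" for x
    by (rule det_minus_1_lagrange[OF S(1,2), symmetric])
qed

section \<open>Polyhedral cones\<close>

lemma ex_linear_orthogonal_projection: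
  fixes L :: "'a::euclidean_space set"
  assumes "subspace L"
  obtains P where "linear P" "\<And>x. P x \<in> L" "\<And>x y. y \<in> L \<Longrightarrow> (x - P x) \<bullet> y = 0"
proof -
  obtain B where B: "B \<subseteq> L" "pairwise orthogonal B" "\<And>x. x \<in> B \<Longrightarrow> norm x = 1"
    "independent B" "span B = L"
    using orthonormal_basis_subspace[OF assms] by metis
  have fin: "finite B" using B(4) by (rule independent_imp_finite)
  define P where "P x = (\<Sum>b\<in>B. (x \<bullet> b) *\<^sub>R b)" for x
  have "linear P"
    unfolding P_def
    by (intro linear_compose_sum ballI linearI) (auto simp: inner_add_left algebra_simps)
  moreover have "P x \<in> L" for x
    using B(1) assms unfolding P_def by (intro subspace_sum subspace_scale) auto
  moreover have "(x - P x) \<bullet> y = 0" if "y \<in> L" for x y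
  proof -
    have "(x - P x) \<bullet> b = 0" if b: "b \<in> B" for b
    proof -
      have "P x \<bullet> b = (\<Sum>c\<in>B. if c = b then x \<bullet> b else 0)"
        unfolding P_def inner_sum_left
      proof (rule sum.cong[OF refl])
        fix c assume c: "c \<in> B"
        show "(x \<bullet> c) *\<^sub>R c \<bullet> b = (if c = b then x \<bullet> b else 0)"
          using B(2,3) b c by (auto simp: pairwise_def orthogonal_def norm_eq_1)
      qed
      then show ?thesis using fin b by (simp add: inner_diff_left)
    qed
    moreover have "y \<in> span B" using that B(5) by simp
    ultimately show ?thesis
      using orthogonal_to_span[of y B "x - P x"] by (simp add: orthogonal_def)
  qed
  ultimately show ?thesis using that by blast
qed

lemma closed_convex_cone_halfspaces:
  fixes A :: "'a::euclidean_space set"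
  shows "closed_convex_cone {z. \<forall>a\<in>A. a \<bullet> z \<ge> 0}"
proof
  have eq: "{z. \<forall>a\<in>A. a \<bullet> z \<ge> 0} = (\<Inter>a\<in>A. {z. a \<bullet> z \<ge> 0})" by auto
  show "closed {z. \<forall>a\<in>A. a \<bullet> z \<ge> 0}"
    unfolding eq by (intro closed_INT ballI closed_halfspace_ge)
  show "convex {z. \<forall>a\<in>A. a \<bullet> z \<ge> 0}"
    unfolding eq by (intro convex_INT convex_halfspace_ge)
  show "cone {z. \<forall>a\<in>A. a \<bullet> z \<ge> 0}" by (auto simp: cone_def)
  show "{z. \<forall>a\<in>A. a \<bullet> z \<ge> 0} \<noteq> {}" by (auto intro: exI[of _ 0])
qed

text \<open>The projection onto a polyhedral cone is linear on each convex set of points whose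
  projection activates a given set of constraints; the frontiers of these finitely many sets
  are negligible.\<close>

lemma polyhedral_proj_differentiable:
  fixes A :: "'a::euclidean_space set"
  assumes A: "finite A" and K: "K = {z. \<forall>a\<in>A. a \<bullet> z \<ge> 0}"
  obtains N where "negligible N" "\<And>x. x \<notin> N \<Longrightarrow> closed_convex_cone.proj K differentiable (at x)"
proof -
  interpret closed_convex_cone K
    unfolding K by (rule closed_convex_cone_halfspaces)
  define L where "L S = {y. \<forall>a\<in>S. a \<bullet> y = 0}" for S :: "'a set"
  have "subspace (L S)" for S by (auto simp: L_def subspace_def inner_add_right)
  then have "\<exists>P. linear P \<and> (\<forall>x. P x \<in> L S) \<and> (\<forall>x y. y \<in> L S \<longrightarrow> (x - P x) \<bullet> y = 0)" for S
    by (metis ex_linear_orthogonal_projection)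
  then obtain P where P: "\<And>S. linear (P S)" "\<And>S x. P S x \<in> L S"
    "\<And>S x y. y \<in> L S \<Longrightarrow> (x - P S x) \<bullet> y = 0" by metis
  define R where "R S = {x. proj x = P S x}" for S
  \<comment> \<open>Moreau's conditions describe \<open>R S\<close> by preimages of convex sets
    under linear maps, which makes it convex; orthogonality is built into
    \<open>P S\<close>.\<close>
  have R_alt: "R S = P S -` K \<inter> (\<Inter>k\<in>K. (\<lambda>x. x - P S x) -` {y. y \<bullet> k \<le> 0})" for S
  proof (intro equalityI subsetI)
    fix x assume "x \<in> R S"
    then show "x \<in> P S -` K \<inter> (\<Inter>k\<in>K. (\<lambda>x. x - P S x) -` {y. y \<bullet> k \<le> 0})"
      using proj_in[of x] proj_polar[of _ x] by (auto simp: R_def)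
  next
    fix x assume "x \<in> P S -` K \<inter> (\<Inter>k\<in>K. (\<lambda>x. x - P S x) -` {y. y \<bullet> k \<le> 0})"
    then have "proj x = P S x" using P(2,3) by (intro proj_eqI) auto
    then show "x \<in> R S" by (simp add: R_def)
  qed
  have convR: "convex (R S)" for S
  proof -
    have "linear (\<lambda>x. x - P S x)" using P(1) by (intro linear_compose_sub linear_ident)
    then show ?thesis unfolding R_alt using P(1)[of S] convex
      by (intro convex_Int convex_INT convex_linear_vimage)
        (auto simp: inner_commute[of _ k for k] convex_halfspace_le)
  qed
  define N where "N = (\<Union>S\<in>Pow A. frontier (R S))"
  have negl: "negligible N"
    unfolding N_def using A by (intro negligible_Union negligible_convex_frontier) (auto intro: negligible_convex_frontier convR)
  have cover: "x \<in> R {a\<in>A. a \<bullet> proj x = 0}" for x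
  proof -
    let ?S = "{a\<in>A. a \<bullet> proj x = 0}"
    \<comment> \<open>From \<open>proj x\<close> one can move a little along \<open>y\<close> in
      either direction without leaving \<open>K\<close>: active constraints vanish on
      \<open>y\<close>, the others have slack. Polarity with both signs gives orthogonality.\<close>
    have orth: "(x - proj x) \<bullet> y = 0" if y: "y \<in> L ?S" for y
    proof -
      have "\<forall>a\<in>A. \<exists>e>0. \<forall>s. \<bar>s\<bar> \<le> e \<longrightarrow> a \<bullet> (proj x + s *\<^sub>R y) \<ge> 0"
      proof
        fix a assume a: "a \<in> A"
        show "\<exists>e>0. \<forall>s. \<bar>s\<bar> \<le> e \<longrightarrow> a \<bullet> (proj x + s *\<^sub>R y) \<ge> 0"
        proof (cases "a \<bullet> proj x = 0")
          case True
          then have "a \<bullet> y = 0" using a y by (auto simp: L_def)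
          then show ?thesis using True by (intro exI[of _ 1]) (simp add: inner_add_right)
        next
          case False
          have pos: "a \<bullet> proj x > 0" using False proj_in[of x] a by (simp add: K order_less_le)
          define e where "e = (a \<bullet> proj x) / (\<bar>a \<bullet> y\<bar> + 1)"
          have "a \<bullet> (proj x + s *\<^sub>R y) \<ge> 0" if "\<bar>s\<bar> \<le> e" for s
          proof -
            have "\<bar>s\<bar> * \<bar>a \<bullet> y\<bar> \<le> e * (\<bar>a \<bullet> y\<bar> + 1)" using that by (intro mult_mono) auto
            also have "\<dots> = a \<bullet> proj x" by (simp add: e_def add_nonneg_eq_0_iff)
            finally have "\<bar>s * (a \<bullet> y)\<bar> \<le> a \<bullet> proj x" by (simp add: abs_mult)
            then show ?thesis by (simp add: inner_add_right)
          qed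
          moreover have "e > 0" using pos by (simp add: e_def add_nonneg_pos)
          ultimately show ?thesis by blast
        qed
      qed
      then obtain e where e: "\<And>a. a \<in> A \<Longrightarrow> e a > 0"
        "\<And>a s. a \<in> A \<Longrightarrow> \<bar>s\<bar> \<le> e a \<Longrightarrow> a \<bullet> (proj x + s *\<^sub>R y) \<ge> 0" by metis
      \<comment> \<open>The inserted 1 keeps the minimum defined when \<open>A\<close> is
        empty.\<close>
      define d where "d = Min (insert 1 (e ` A))"
      have d: "d > 0" unfolding d_def using A e(1) by (subst Min_gr_iff) auto
      have d_le: "d \<le> e a" if "a \<in> A" for a unfolding d_def using A that by (intro Min_le) auto
      have in_K: "proj x + s *\<^sub>R y \<in> K" if "\<bar>s\<bar> \<le> d" for s
        using e(2) d_le that unfolding K by fastforce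
      have "(x - proj x) \<bullet> (d *\<^sub>R y) \<le> 0" "(x - proj x) \<bullet> ((- d) *\<^sub>R y) \<le> 0"
        using proj_polar[OF in_K[of d], of x] proj_polar[OF in_K[of "- d"], of x] d proj_orth[of x]
        by (auto simp: inner_add_right inner_diff_right)
      then have "d * ((x - proj x) \<bullet> y) \<le> 0" "d * ((x - proj x) \<bullet> y) \<ge> 0" by simp_all
      then have "d * ((x - proj x) \<bullet> y) = 0" by (rule antisym)
      then show ?thesis using d by simp
    qed
    have proj_L: "proj x \<in> L ?S" by (simp add: L_def)
    have diff_L: "proj x - P ?S x \<in> L ?S"
      using \<open>\<And>S. subspace (L S)\<close> proj_L P(2) by (rule subspace_diff)
    \<comment> \<open>The difference of the two points lies in \<open>L ?S\<close>, and both
      \<open>x - proj x\<close> and \<open>x - P ?S x\<close> are orthogonal to \<open>L ?S\<close>;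
      so it is orthogonal to itself.\<close>
    have "(proj x - P ?S x) \<bullet> (proj x - P ?S x) = 0"
      using orth[OF diff_L] P(3)[OF diff_L, of x]
      by (simp only: inner_diff_left[of "proj x" "P ?S x"] inner_diff_left[of x])
    then show ?thesis by (simp add: R_def)
  qed
  have "proj differentiable (at x)" if "x \<notin> N" for x
  proof -
    let ?S = "{a\<in>A. a \<bullet> proj x = 0}"
    have "x \<notin> frontier (R ?S)" using that by (auto simp: N_def)
    then have int: "x \<in> interior (R ?S)"
      using cover[of x] closure_subset by (auto simp: frontier_def)
    have "(P ?S has_derivative P ?S) (at x)"
      using P(1) linear_conv_bounded_linear bounded_linear_imp_has_derivative by blast
    then have "(proj has_derivative P ?S) (at x)"
      by (rule has_derivative_transform_within_open[OF _ open_interior int])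
        (use interior_subset[of "R ?S"] in \<open>auto simp: R_def\<close>)
    then show ?thesis by (auto simp: differentiable_def)
  qed
  with negl show ?thesis using that by blast
qed

section \<open>A vanishing signed volume\<close>

text \<open>Change the vector at a fixed scaling factor, then the factor; each change costs at most
  \<open>norm (u - w) / norm u\<close>.\<close>

lemma norm_sgn_diff_le:
  fixes u w :: "'a::real_normed_vector"
  assumes "u \<noteq> 0" "w \<noteq> 0"
  shows "norm (sgn u - sgn w) \<le> 2 * norm (u - w) / norm u"
proof -
  define a b where "a = inverse (norm u)" and "b = inverse (norm w)"
  have a: "a > 0" using assms by (simp add: a_def)
  have "sgn u - sgn w = a *\<^sub>R (u - w) + (a - b) *\<^sub>R w"
    by (simp add: a_def b_def sgn_div_norm algebra_simps)
  then have "norm (sgn u - sgn w) \<le> norm (a *\<^sub>R (u - w)) + norm ((a - b) *\<^sub>R w)"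
    by (simp only: norm_triangle_ineq)
  also have "norm (a *\<^sub>R (u - w)) = a * norm (u - w)"
    using a by simp
  also have "norm ((a - b) *\<^sub>R w) = a * \<bar>norm w - norm u\<bar>"
  proof -
    have b: "b > 0" "b * norm w = 1" using assms by (simp_all add: b_def)
    have "a * norm u = 1" using assms by (simp add: a_def)
    have "a * b * (norm w - norm u) = a * (b * norm w) - b * (a * norm u)"
      by (simp only: right_diff_distrib mult.assoc mult.left_commute)
    then have ab: "a - b = a * b * (norm w - norm u)"
      by (simp only: b(2) \<open>a * norm u = 1\<close> mult_1_right)
    have "norm ((a - b) *\<^sub>R w) = (b * norm w) * (a * \<bar>norm w - norm u\<bar>)"
      unfolding ab using a b(1) by (simp only: norm_scaleR abs_mult abs_of_pos mult_ac)
    then show ?thesis by (simp only: b(2) mult_1)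
  qed
  also have "\<dots> \<le> a * norm (u - w)"
    using norm_triangle_ineq3[of w u] a by (intro mult_left_mono) (simp_all add: norm_minus_commute)
  finally have "norm (sgn u - sgn w) \<le> 2 * (a * norm (u - w))" by simp
  also have "\<dots> = 2 * norm (u - w) / norm u" by (simp add: a_def divide_inverse)
  finally show ?thesis .
qed

lemma norm_scaleR_diff_le:
  fixes x y :: "'a::real_normed_vector"
  shows "norm (a *\<^sub>R x - b *\<^sub>R y) \<le> \<bar>a - b\<bar> * norm y + \<bar>a\<bar> * norm (x - y)"
proof -
  have "a *\<^sub>R x - b *\<^sub>R y = (a - b) *\<^sub>R y + a *\<^sub>R (x - y)" by (simp add: algebra_simps)
  then show ?thesis
    using norm_triangle_ineq[of "(a - b) *\<^sub>R y" "a *\<^sub>R (x - y)"] by simp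
qed

text \<open>A norm-preserving map that misses an open half-space is deformed, inside the unit ball
  only, into a map with values in the unit sphere, whose Jacobian therefore vanishes.\<close>

definition push_to_sphere :: "'a::real_inner \<Rightarrow> ('a \<Rightarrow> 'a) \<Rightarrow> 'a \<Rightarrow> 'a" where
  "push_to_sphere v G x = G x + max 0 (1 - norm x) *\<^sub>R v"

text \<open>The map \<open>H\<close> of the overview when \<open>G\<close> is the reflection. The
  radius is 1 on the unit ball and \<open>norm x\<close> outside, where the push is zero and a
  norm-preserving \<open>G\<close> is recovered.\<close>

definition spherical_extension :: "'a::real_inner \<Rightarrow> ('a \<Rightarrow> 'a) \<Rightarrow> 'a \<Rightarrow> 'a" where
  "spherical_extension v G x = max 1 (norm x) *\<^sub>R sgn (push_to_sphere v G x)"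

text \<open>Isometric refers to norms only; distances may shrink. The model is
  \<open>stretch (-1)\<close> for a cone that is not a subspace.\<close>

locale halfspace_isometric_map =
  fixes v :: "'a::euclidean_space" and G :: "'a \<Rightarrow> 'a"
  assumes v: "norm v = 1" and norm_G: "\<And>x. norm (G x) = norm x"
    and halfspace: "\<And>x. v \<bullet> G x \<ge> 0"
    and lip: "\<And>x y. norm (G x - G y) \<le> norm (x - y)"
begin

abbreviation "pushed \<equiv> push_to_sphere v G"
abbreviation "spherical \<equiv> spherical_extension v G"

text \<open>Inside the ball, with \<open>r = norm x\<close>, the half-space condition makes the
  cross term nonnegative, so the squared norm is at least \<open>r^2 + (1 - r)^2 \<ge> 1/4\<close>.
  The pushed point stays away from the origin and can be normalised.\<close>

lemma norm_pushed: "norm (pushed x) \<ge> max 1 (norm x) / 2"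
proof (cases "norm x \<ge> 1")
  case True
  then show ?thesis by (simp add: push_to_sphere_def norm_G)
next
  case False
  define s where "s = 1 - norm x"
  have s: "s > 0" using False by (simp add: s_def)
  have "(norm (pushed x))\<^sup>2 = (norm (G x))\<^sup>2 + 2 * s * (v \<bullet> G x) + s\<^sup>2 * (norm v)\<^sup>2"
  proof -
    have "pushed x = G x + s *\<^sub>R v" using s by (simp add: push_to_sphere_def s_def)
    then show ?thesis
      unfolding power2_norm_eq_inner power2_eq_square[of s]
      by (simp only: inner_add_left inner_add_right inner_scaleR_left inner_scaleR_right
          inner_commute[of "G x" v]) (simp only: mult.assoc mult_2 distrib_left distrib_right add.assoc)
  qed
  then have "(norm x)\<^sup>2 + s\<^sup>2 \<le> (norm (pushed x))\<^sup>2"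
    using halfspace[of x] s by (simp add: norm_G v)
  moreover have "(norm x)\<^sup>2 + s\<^sup>2 = (1 / 2)\<^sup>2 + (2 * norm x - 1)\<^sup>2 / 2 + 1 / 4"
    by (simp add: s_def power2_eq_square field_simps)
  ultimately have "(1 / 2)\<^sup>2 \<le> (norm (pushed x))\<^sup>2"
    using zero_le_power2[of "2 * norm x - 1"] by linarith
  then have "1 / 2 \<le> norm (pushed x)" by (rule power2_le_imp_le) simp
  then show ?thesis using False by simp
qed

lemma pushed_nonzero: "pushed x \<noteq> 0"
proof
  assume "pushed x = 0"
  then have "max 1 (norm x) \<le> 0" using norm_pushed[of x] by simp
  then show False by simp
qed

lemma pushed_lipschitz: "norm (pushed x - pushed y) \<le> 2 * norm (x - y)"
proof -
  have "pushed x - pushed y = (G x - G y) + (max 0 (1 - norm x) - max 0 (1 - norm y)) *\<^sub>R v"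
    by (simp add: push_to_sphere_def algebra_simps)
  then have "norm (pushed x - pushed y) \<le> norm (G x - G y) + \<bar>max 0 (1 - norm x) - max 0 (1 - norm y)\<bar>"
    using norm_triangle_ineq[of "G x - G y" "(max 0 (1 - norm x) - max 0 (1 - norm y)) *\<^sub>R v"]
    by (simp add: v)
  also have "\<bar>max 0 (1 - norm x) - max 0 (1 - norm y)\<bar> \<le> \<bar>norm x - norm y\<bar>" by (auto simp: max_def)
  also have "\<dots> \<le> norm (x - y)" by (rule norm_triangle_ineq3)
  finally show ?thesis using lip[of x y] by simp
qed

lemma norm_sgn_pushed: "norm (sgn (pushed x)) = 1"
  using pushed_nonzero[of x] by (simp add: norm_sgn)

text \<open>The constant is 1 + 8. The radius contributes 1; the direction times the radius
  contributes 8, from the factor 2 in \<open>norm_sgn_diff_le\<close>, the constant 2 of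
  \<open>pushed\<close> and its lower bound \<open>m / 2\<close>.\<close>

lemma spherical_lipschitz: "norm (spherical x - spherical y) \<le> 9 * norm (x - y)"
proof -
  define m where "m = max 1 (norm x)"
  have m: "m > 0" "m / 2 \<le> norm (pushed x)"
    using norm_pushed[of x] by (auto simp: m_def)
  have "norm (sgn (pushed x) - sgn (pushed y))
      \<le> 2 * norm (pushed x - pushed y) / norm (pushed x)"
    by (intro norm_sgn_diff_le pushed_nonzero)
  also have "\<dots> \<le> 2 * norm (pushed x - pushed y) / (m / 2)"
    using m by (intro divide_left_mono mult_pos_pos) auto
  also have "\<dots> = 4 * norm (pushed x - pushed y) / m" by simp
  also have "\<dots> \<le> 8 * norm (x - y) / m"
    using pushed_lipschitz[of x y] m by (intro divide_right_mono) auto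
  finally have "m * norm (sgn (pushed x) - sgn (pushed y))
      \<le> m * (8 * norm (x - y) / m)"
    using m by (intro mult_left_mono) auto
  also have "\<dots> = 8 * norm (x - y)" using m by simp
  finally have "m * norm (sgn (pushed x) - sgn (pushed y))
      \<le> 8 * norm (x - y)" .
  moreover have "\<bar>m - max 1 (norm y)\<bar> \<le> norm (x - y)"
    using norm_triangle_ineq3[of x y] unfolding m_def by linarith
  ultimately have "\<bar>m - max 1 (norm y)\<bar> * 1 + \<bar>m\<bar> * norm (sgn (pushed x) - sgn (pushed y))
      \<le> norm (x - y) + 8 * norm (x - y)"
    using m(1) by simp
  from order_trans[OF norm_scaleR_diff_le[of _ "sgn (pushed x)" _ "sgn (pushed y)", unfolded norm_sgn_pushed] this]
  show ?thesis by (simp add: spherical_extension_def m_def)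
qed

lemma spherical_eq: "norm x \<ge> 1 \<Longrightarrow> spherical x = G x"
proof -
  assume x: "norm x \<ge> 1"
  then have "pushed x = G x" by (simp add: push_to_sphere_def)
  moreover have "max 1 (norm x) = norm (G x)" using x by (simp add: norm_G)
  moreover have "norm (G x) \<noteq> 0" using x norm_G[of x] by linarith
  ultimately show ?thesis by (simp add: spherical_extension_def sgn_div_norm)
qed

lemma spherical_norm: "norm x \<le> 1 \<Longrightarrow> norm (spherical x) = 1"
  by (simp add: spherical_extension_def norm_sgn_pushed)

text \<open>In the ball the maxima are \<open>1\<close> and \<open>1 - norm y\<close>; the origin is
  left out because the norm is not differentiable there.\<close>

lemma spherical_differentiable:
  assumes x: "x \<in> ball 0 1" "x \<noteq> 0" and G: "G differentiable (at x)"
  shows "spherical differentiable (at x)"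
proof -
  let ?w = "\<lambda>x. G x + (1 - norm x) *\<^sub>R v"
  have eq: "pushed y = ?w y" if "y \<in> ball 0 1" for y
    using that by (simp add: push_to_sphere_def)
  have "?w x \<noteq> 0" using pushed_nonzero[of x] eq[OF x(1)] by simp
  moreover have w: "?w differentiable (at x)"
    using x(2) G by (intro differentiable_add differentiable_scaleR differentiable_diff
        differentiable_const differentiable_norm_at) auto
  moreover have "(\<lambda>y. norm (?w y)) differentiable (at x)"
    using differentiable_chain_at[OF w differentiable_norm_at] \<open>?w x \<noteq> 0\<close> by (simp add: o_def)
  ultimately have "(\<lambda>y. inverse (norm (?w y)) *\<^sub>R ?w y) differentiable (at x)"
    by (intro differentiable_scaleR differentiable_inverse) auto
  then obtain D where "((\<lambda>y. inverse (norm (?w y)) *\<^sub>R ?w y) has_derivative D) (at x)"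
    by (auto simp: differentiable_def)
  then have "(spherical has_derivative D) (at x)"
    by (rule has_derivative_transform_within_open[OF _ open_ball x(1)])
      (simp add: spherical_extension_def eq sgn_div_norm)
  then show ?thesis by (auto simp: differentiable_def)
qed

text \<open>Differentiate \<open>spherical y \<bullet> spherical y = 1\<close>. The derivative maps
  into a hyperplane, so its determinant vanishes.\<close>

lemma spherical_derivative_orth:
  assumes x: "x \<in> ball 0 1" and D: "(spherical has_derivative D) (at x)"
  shows "spherical x \<bullet> D h = 0"
proof -
  have "((\<lambda>y. spherical y \<bullet> spherical y) has_derivative (\<lambda>h. spherical x \<bullet> D h + D h \<bullet> spherical x)) (at x)"
    using D D by (rule has_derivative_inner)
  then have "((\<lambda>y. 1) has_derivative (\<lambda>h. spherical x \<bullet> D h + D h \<bullet> spherical x)) (at x)"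
    by (rule has_derivative_transform_within_open[OF _ open_ball x])
      (metis mem_ball_0 less_imp_le norm_eq_1 spherical_norm)
  then have "(\<lambda>h. spherical x \<bullet> D h + D h \<bullet> spherical x) = (\<lambda>h. 0)"
    using has_derivative_const by (rule has_derivative_unique)
  then show ?thesis by (metis inner_commute add_cancel_right_right mult_2 mult_eq_0_iff zero_neq_numeral)
qed

end

section \<open>The argument of Milnor and Rogers\<close>

lemma det_eq_0_if_orthogonal:
  fixes f :: "real^'n \<Rightarrow> real^'n"
  assumes f: "linear f" and u: "u \<noteq> 0" "\<And>h. u \<bullet> f h = 0"
  shows "det (matrix f) = 0"
proof (rule ccontr)
  assume "det (matrix f) \<noteq> 0"
  then have "surj f" using det_nz_iff_inj[OF f] linear_injective_imp_surjective[OF f] by blast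
  then obtain h where "f h = u" by (metis surjD)
  then show False using u(2)[of h] u(1) by simp
qed

text \<open>Both blends are bijections of the whole space. They agree off \<open>B\<close>, so they
  map its complement, and therefore also \<open>B\<close>, onto the same set.\<close>

lemma blend_image_ball_cong:
  fixes G H :: "'a::{banach,perfect_space} \<Rightarrow> 'a"
  assumes G: "\<And>x y. norm (G x - G y) \<le> L * norm (x - y)"
    and H: "\<And>x y. norm (H x - H y) \<le> L * norm (x - y)"
    and L: "L \<ge> 0" and t: "t \<le> 1" "(1 - t) * L < 1 + t"
    and eq: "\<And>x. x \<notin> B \<Longrightarrow> G x = H x"
  shows "blend t G ` B = blend t H ` B"
proof -
  have *: "blend t F ` B = - (blend t F ` (- B))"
    if F: "\<And>x y. norm (F x - F y) \<le> L * norm (x - y)" for F :: "'a \<Rightarrow> 'a"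
  proof -
    have "inj (blend t F)" using blend_inj_bound[OF F t] by (auto intro: injI)
    moreover have "surj (blend t F)" using blend_surj[OF F L t] by (metis surjI)
    ultimately show ?thesis by (metis bij_def bij_image_Compl_eq double_complement)
  qed
  have "blend t G ` (- B) = blend t H ` (- B)"
    by (rule image_cong) (auto simp: blend_def eq)
  then show ?thesis using *[OF G] *[OF H] by simp
qed

lemma ex_finite_near_1:
  fixes c :: real assumes "c < 1"
  obtains S where "finite S" "card S = n" "S \<subseteq> {c<..<1}"
proof -
  have "infinite {c<..<1}" using assms by (rule infinite_Ioo)
  then show ?thesis using infinite_arbitrarily_large that by blast
qed

text \<open>Nodes close to 1 identify the signed volume of \<open>G\<close> with that of its
  spherical extension, which is 0; independence of the nodes transfers this to
  \<open>S\<close>.\<close>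

lemma sum_lagrange_volume_halfspace:
  fixes G :: "real^'n::{finite,wellorder} \<Rightarrow> real^'n::_"
  assumes "halfspace_isometric_map v G"
    and N: "negligible N" "\<And>x. x \<notin> N \<Longrightarrow> G differentiable (at x)"
    and S: "finite S" "CARD('n) < card S" "S \<subseteq> {0<..1}"
  shows "(\<Sum>t\<in>S. lagrange_weight S t * measure lebesgue (blend t G ` ball 0 1)) = 0"
proof -
  interpret halfspace_isometric_map v G by fact
  let ?H = "spherical_extension v G"
  define N' where "N' = insert 0 N"
  have N': "negligible N'" using N(1) by (simp add: N'_def)
  obtain G' where G': "\<And>x. x \<notin> N \<Longrightarrow> (G has_derivative G' x) (at x)"
    using N(2) unfolding differentiable_def by metis
  then have G'N': "\<And>x. x \<in> ball 0 1 - N' \<Longrightarrow> (G has_derivative G' x) (at x)" by (auto simp: N'_def)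
  have "\<forall>x\<in>ball 0 1 - N'. ?H differentiable (at x)"
    using spherical_differentiable N(2) by (auto simp: N'_def)
  then obtain H' where H': "\<And>x. x \<in> ball 0 1 - N' \<Longrightarrow> (?H has_derivative H' x) (at x)"
    unfolding differentiable_def by metis
  have detH: "det (matrix (H' x)) = 0" if x: "x \<in> ball 0 1 - N'" for x
  proof (rule det_eq_0_if_orthogonal)
    show "linear (H' x)" using H'[OF x] by (rule has_derivative_linear)
    show "?H x \<noteq> 0" using spherical_norm[of x] x by auto
    show "?H x \<bullet> H' x h = 0" for h using spherical_derivative_orth[OF _ H'[OF x]] x by simp
  qed
  have lipG: "norm (G x - G y) \<le> 1 * norm (x - y)" for x y using lip by simp
  have lipG9: "norm (G x - G y) \<le> 9 * norm (x - y)" for x y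
    using lip[of x y] norm_ge_zero[of "x - y"] by linarith
  \<comment> \<open>Nodes above 9/10 satisfy \<open>(1 - t) * 9 < 1 + t\<close>, the condition for
    the Lipschitz constant 9 of the spherical extension.\<close>
  obtain S1 where S1: "finite S1" "card S1 = CARD('n) + 1" "S1 \<subseteq> {9/10<..<1 :: real}"
    using ex_finite_near_1[of "9/10"] by auto
  have S1': "t \<le> 1 \<and> (1 - t) * 9 < 1 + t" if "t \<in> S1" for t using S1(3) that by auto
  have "measure lebesgue (blend t G ` ball 0 1) = measure lebesgue (blend t ?H ` ball 0 1)"
    if t: "t \<in> S1" for t
    using blend_image_ball_cong[of G 9 ?H t "ball 0 1"] lipG9 spherical_lipschitz S1'[OF t] spherical_eq
    by (simp add: not_less)
  then have sum_eq: "(\<Sum>t\<in>S1. lagrange_weight S1 t * measure lebesgue (blend t G ` ball 0 1))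
      = (\<Sum>t\<in>S1. lagrange_weight S1 t * measure lebesgue (blend t ?H ` ball 0 1))" by simp
  have "((\<lambda>x. det (matrix (H' x))) has_integral
      (\<Sum>t\<in>S1. lagrange_weight S1 t * measure lebesgue (blend t ?H ` ball 0 1))) (ball 0 1 - N')"
    using S1 S1' by (intro sum_lagrange_volume[OF spherical_lipschitz _ _ _ _ N' H']) auto
  moreover have "((\<lambda>x. det (matrix (H' x))) has_integral 0) (ball 0 1 - N')"
    using detH by (intro has_integral_is_0) auto
  ultimately have "(\<Sum>t\<in>S1. lagrange_weight S1 t * measure lebesgue (blend t ?H ` ball 0 1)) = 0"
    by (rule has_integral_unique)
  moreover have "((\<lambda>x. det (matrix (G' x))) has_integral
      (\<Sum>t\<in>S1. lagrange_weight S1 t * measure lebesgue (blend t G ` ball 0 1))) (ball 0 1 - N')"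
    using S1 S1' by (intro sum_lagrange_volume[OF lipG9 _ _ _ _ N' G'N']) auto
  ultimately have "((\<lambda>x. det (matrix (G' x))) has_integral 0) (ball 0 1 - N')"
    by (simp add: sum_eq)
  \<comment> \<open>For \<open>G\<close> itself the Lipschitz constant 1 admits all nodes in
    \<open>{0<..1}\<close>.\<close>
  moreover have "((\<lambda>x. det (matrix (G' x))) has_integral
      (\<Sum>t\<in>S. lagrange_weight S t * measure lebesgue (blend t G ` ball 0 1))) (ball 0 1 - N')"
    using S by (intro sum_lagrange_volume[OF lipG _ _ _ _ N' G'N']) auto
  ultimately show ?thesis by (rule has_integral_unique[symmetric])
qed

text \<open>Inverting \<open>stretch t\<close> by \<open>stretch (1 / t)\<close> presents the image
  of the ball as a sublevel set, the shape that Gaussian integration needs.\<close>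

lemma sum_lagrange_stretch_volume:
  fixes K :: "(real^'n::{finite,wellorder}) set"
  assumes A: "finite A" and K: "K = {z. \<forall>a\<in>A. a \<bullet> z \<ge> 0}" and k: "k \<in> K" "- k \<notin> K"
    and S: "finite S" "CARD('n) < card S" "S \<subseteq> {0<..1}"
  shows "(\<Sum>t\<in>S. lagrange_weight S t *
    measure lebesgue {z. norm (closed_convex_cone.stretch K (1 / t) z) < 1}) = 0"
proof -
  interpret closed_convex_cone K
    unfolding K by (rule closed_convex_cone_halfspaces)
  obtain v where v: "norm v = 1" "\<And>x. v \<bullet> stretch (-1) x \<ge> 0"
    using stretch_halfspace[OF k] by blast
  have iso: "halfspace_isometric_map v (stretch (-1))"
    using v norm_stretch_minus_1 stretch_minus_1_nonexpansive by unfold_locales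
  obtain N where N: "negligible N" "\<And>x. x \<notin> N \<Longrightarrow> proj differentiable (at x)"
    using polyhedral_proj_differentiable[OF A K] by blast
  have diff: "stretch (-1) differentiable (at x)" if "x \<notin> N" for x
    unfolding stretch_def[abs_def] using N(2)[OF that]
    by (intro differentiable_add differentiable_scaleR differentiable_diff
        differentiable_const differentiable_ident) auto
  have blend: "blend t (stretch (-1)) = stretch t" for t
  proof
    fix x
    have "blend t (stretch (-1)) x = ((1 + t) / 2) *\<^sub>R (proj x + (x - proj x))
        + ((1 - t) / 2) *\<^sub>R (proj x - (x - proj x))"
      by (simp add: blend_def stretch_def)
    also have "\<dots> = ((1 + t) / 2 + (1 - t) / 2) *\<^sub>R proj x + ((1 + t) / 2 - (1 - t) / 2) *\<^sub>R (x - proj x)"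
      by (simp only: scaleR_add_right scaleR_diff_right scaleR_add_left scaleR_diff_left) simp
    also have "\<dots> = stretch t x" by (simp add: stretch_def flip: add_divide_distrib diff_divide_distrib)
    finally show "blend t (stretch (-1)) x = stretch t x" .
  qed
  have image: "stretch t ` ball 0 1 = {z. norm (stretch (1 / t) z) < 1}" if "t \<in> S" for t
  proof -
    have t: "t > 0" using that S(3) by auto
    have *: "stretch (1 / t) (stretch t x) = x" "stretch t (stretch (1 / t) x) = x" for x
      using t by (simp_all add: stretch_stretch)
    have "z \<in> stretch t ` ball 0 1 \<longleftrightarrow> norm (stretch (1 / t) z) < 1" for z
    proof
      assume "norm (stretch (1 / t) z) < 1"
      then have "stretch (1 / t) z \<in> ball 0 1" by simp
      with *(2)[of z] show "z \<in> stretch t ` ball 0 1" by (metis image_eqI)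
    next
      assume "z \<in> stretch t ` ball 0 1"
      then obtain y where "norm y < 1" "z = stretch t y" by auto
      with *(1)[of y] show "norm (stretch (1 / t) z) < 1" by metis
    qed
    then show ?thesis by blast
  qed
  show ?thesis
    using sum_lagrange_volume_halfspace[OF iso N(1) diff S] by (simp add: blend image)
qed

section \<open>Gaussian integrals and general cones\<close>

lemma emeasure_sublevel_homogeneous:
  fixes f :: "'a::euclidean_space \<Rightarrow> real"
  assumes [measurable]: "f \<in> borel_measurable borel" and hom: "\<And>r z. r > 0 \<Longrightarrow> f (r *\<^sub>R z) = r\<^sup>2 * f z"
    and s: "s > 0"
  shows "emeasure lborel {z. f z < s} = ennreal (sqrt s ^ DIM('a)) * emeasure lborel {z. f z < 1}"
proof -
  have c: "sqrt s > 0" using s by simp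
  have sets [measurable]: "{z. f z < s} \<in> sets borel" for s by measurable
  have "emeasure lborel {z. f z < s} = (\<integral>\<^sup>+z. indicator {z. f z < s} z \<partial>lborel)"
    by simp
  also have "\<dots> = (\<integral>\<^sup>+z. ennreal (sqrt s ^ DIM('a)) * indicator {z. f z < s} (sqrt s *\<^sub>R z) \<partial>lborel)"
    using c by (subst lborel_affine[of "sqrt s" 0]) (simp_all add: nn_integral_density nn_integral_distr del: nn_integral_indicator)
  also have "\<dots> = (\<integral>\<^sup>+z. ennreal (sqrt s ^ DIM('a)) * indicator {z. f z < 1} z \<partial>lborel)"
    using s hom[OF c] by (intro nn_integral_cong) (auto simp: indicator_def)
  also have "\<dots> = ennreal (sqrt s ^ DIM('a)) * emeasure lborel {z. f z < 1}"
    by (simp add: nn_integral_cmult)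
  finally show ?thesis .
qed

text \<open>The value is \<open>2 powr (n / 2) * Gamma (n / 2 + 1)\<close>; as it depends on the
  dimension alone, it factors out of sums over \<open>t\<close>.\<close>

definition gauss_radial_const :: "nat \<Rightarrow> ennreal" where
  "gauss_radial_const n =
    (\<integral>\<^sup>+s. ennreal (exp (- s / 2) / 2) * ennreal (sqrt s ^ n) * indicator {0<..} s \<partial>lborel)"

text \<open>Layer cake: \<open>exp (- c / 2)\<close> is the integral of
  \<open>exp (- s / 2) / 2\<close> over \<open>s > c\<close>. After exchanging the integrals, each
  sublevel set with \<open>s > 0\<close> is a scaled copy of \<open>{z. f z < 1}\<close>.\<close>

lemma nn_integral_exp_homogeneous:
  fixes f :: "'a::euclidean_space \<Rightarrow> real"
  assumes [measurable]: "f \<in> borel_measurable borel" and hom: "\<And>r z. r > 0 \<Longrightarrow> f (r *\<^sub>R z) = r\<^sup>2 * f z"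
    and nonneg: "\<And>z. f z \<ge> 0"
  shows "(\<integral>\<^sup>+z. ennreal (exp (- f z / 2)) \<partial>lborel) = gauss_radial_const DIM('a) * emeasure lborel {z. f z < 1}"
proof -
  let ?g = "\<lambda>s::real. exp (- s / 2) / 2"
  have layer: "ennreal (exp (- c / 2)) = (\<integral>\<^sup>+s. (if c < s then ennreal (?g s) else 0) \<partial>lborel)" for c :: real
  proof -
    have "(\<integral>\<^sup>+s. ennreal (?g s) * indicator {c..} s \<partial>lborel) = ennreal (0 - (- exp (- c / 2)))"
    proof (rule nn_integral_FTC_atLeast)
      show "((\<lambda>s. - exp (- s / 2)) has_real_derivative ?g s) (at s)" for s
        by (auto intro!: derivative_eq_intros)
      show "((\<lambda>s::real. - exp (- s / 2)) \<longlongrightarrow> 0) at_top" by real_asymp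
    qed auto
    moreover have "(\<integral>\<^sup>+s. ennreal (?g s) * indicator {c..} s \<partial>lborel)
        = (\<integral>\<^sup>+s. (if c < s then ennreal (?g s) else 0) \<partial>lborel)"
      using AE_lborel_singleton[of c]
      by (intro nn_integral_cong_AE, eventually_elim) (auto simp: indicator_def)
    ultimately show ?thesis by simp
  qed
  have "(\<integral>\<^sup>+z. ennreal (exp (- f z / 2)) \<partial>lborel)
      = (\<integral>\<^sup>+z. (\<integral>\<^sup>+s. (if f z < s then ennreal (?g s) else 0) \<partial>lborel) \<partial>lborel)"
    by (simp only: layer)
  also have "\<dots> = (\<integral>\<^sup>+s. (\<integral>\<^sup>+z. (if f z < s then ennreal (?g s) else 0) \<partial>lborel) \<partial>lborel)"
    by (rule lborel_pair.Fubini'[symmetric]) measurable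
  also have "\<dots> = (\<integral>\<^sup>+s. ennreal (?g s) * ennreal (sqrt s ^ DIM('a)) * indicator {0<..} s
      * emeasure lborel {z. f z < 1} \<partial>lborel)"
  proof (rule nn_integral_cong)
    fix s :: real
    have [measurable]: "{z. f z < s} \<in> sets borel" by measurable
    have "(\<integral>\<^sup>+z. (if f z < s then ennreal (?g s) else 0) \<partial>lborel)
        = (\<integral>\<^sup>+z. ennreal (?g s) * indicator {z. f z < s} z \<partial>lborel)"
      by (intro nn_integral_cong) (auto simp: indicator_def)
    also have "\<dots> = ennreal (?g s) * emeasure lborel {z. f z < s}"
      by (subst nn_integral_cmult) auto
    also have "\<dots> = ennreal (?g s) * ennreal (sqrt s ^ DIM('a)) * indicator {0<..} s
      * emeasure lborel {z. f z < 1}"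
    proof (cases "s > 0")
      case True
      then show ?thesis by (simp add: emeasure_sublevel_homogeneous[OF assms(1) hom True] mult.assoc)
    next
      case False
      then have "\<not> f z < s" for z using nonneg[of z] by linarith
      then have "{z. f z < s} = {}" by simp
      then show ?thesis using False by simp
    qed
    finally show "(\<integral>\<^sup>+z. (if f z < s then ennreal (?g s) else 0) \<partial>lborel) = \<dots>" .
  qed
  also have "\<dots> = gauss_radial_const DIM('a) * emeasure lborel {z. f z < 1}"
    unfolding gauss_radial_const_def by (rule nn_integral_multc) measurable
  finally show ?thesis .
qed

context closed_convex_cone
begin

lemma norm_le_stretch:
  assumes "0 < t" "t \<le> 1"
  shows "norm z \<le> norm (stretch (1 / t) z)"
proof -
  have "1 * (norm (z - proj z))\<^sup>2 \<le> (1 / t)\<^sup>2 * (norm (z - proj z))\<^sup>2"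
    using assms by (intro mult_right_mono) (auto simp: power_one_over one_le_inverse_iff field_simps power_le_one)
  then have "(norm z)\<^sup>2 \<le> (norm (stretch (1 / t) z))\<^sup>2"
    unfolding norm_stretch by (subst pythagoras) simp
  then show ?thesis by simp
qed

lemma stretch_borel [measurable]: "stretch t \<in> borel_measurable borel"
  using continuous_on_stretch by (rule borel_measurable_continuous_onI)

text \<open>Up to normalisation, the standard normal density times
  \<open>exp (- r * (norm (z - proj z))^2)\<close> with \<open>r = (1 / t^2 - 1) / 2\<close>: its
  integral is a Laplace transform of the squared distance to \<open>K\<close>.\<close>

definition gauss_stretch :: "real \<Rightarrow> 'a \<Rightarrow> real" where
  "gauss_stretch t z = exp (- (norm (stretch (1 / t) z))\<^sup>2 / 2)"

lemma gauss_stretch_borel [measurable]: "gauss_stretch t \<in> borel_measurable borel"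
  unfolding gauss_stretch_def[abs_def] by measurable

text \<open>A majorant independent of the cone, for the passage to the limit over cones.\<close>

lemma gauss_stretch_le:
  assumes "0 < t" "t \<le> 1"
  shows "gauss_stretch t z \<le> exp (- (norm z)\<^sup>2 / 2)"
  using norm_le_stretch[OF assms, of z] by (simp add: gauss_stretch_def)

text \<open>\<open>enn2real\<close> sends infinity to \<open>0\<close>, as does the integral of a function that is not integrable.\<close>

lemma integral_gauss_stretch:
  "(\<integral>z. gauss_stretch t z \<partial>lborel)
    = enn2real (gauss_radial_const DIM('a)) * measure lebesgue {z. norm (stretch (1 / t) z) < 1}"
proof -
  have "(\<integral>\<^sup>+z. ennreal (gauss_stretch t z) \<partial>lborel)
      = gauss_radial_const DIM('a) * emeasure lborel {z. (norm (stretch (1 / t) z))\<^sup>2 < 1}"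
    unfolding gauss_stretch_def
    by (rule nn_integral_exp_homogeneous) (auto simp: stretch_scale power_mult_distrib)
  also have "{z. (norm (stretch (1 / t) z))\<^sup>2 < 1} = {z. norm (stretch (1 / t) z) < 1}"
    by (simp add: abs_square_less_1 set_eq_iff)
  finally have *: "(\<integral>\<^sup>+z. ennreal (gauss_stretch t z) \<partial>lborel)
      = gauss_radial_const DIM('a) * emeasure lborel {z. norm (stretch (1 / t) z) < 1}" .
  have "(\<integral>z. gauss_stretch t z \<partial>lborel) = enn2real (\<integral>\<^sup>+z. ennreal (gauss_stretch t z) \<partial>lborel)"
    by (rule integral_eq_nn_integral) (auto simp: gauss_stretch_def)
  also have "\<dots> = enn2real (gauss_radial_const DIM('a)) * measure lborel {z. norm (stretch (1 / t) z) < 1}"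
    unfolding * by (simp add: enn2real_mult measure_def)
  also have "measure lborel {z. norm (stretch (1 / t) z) < 1} = measure lebesgue {z. norm (stretch (1 / t) z) < 1}"
    by (rule measure_completion[symmetric]) measurable
  finally show ?thesis .
qed

end

section \<open>Decreasing limits of cones\<close>

text \<open>The squared distances to \<open>K m\<close> increase and are bounded, and by the
  variational inequality their increments bound the squared distances between the projections, which
  thus form a Cauchy sequence. Its limit lies in every \<open>K m\<close> and is no farther from
  \<open>x\<close> than the closest point of the intersection.\<close>

lemma closest_point_INT_tendsto:
  fixes K :: "nat \<Rightarrow> 'a::euclidean_space set"
  assumes closed: "\<And>m. closed (K m)" and convex: "\<And>m. convex (K m)" and dec: "decseq K"
    and ne: "(\<Inter>m. K m) \<noteq> {}"
  shows "(\<lambda>m. closest_point (K m) x) \<longlonglongrightarrow> closest_point (\<Inter>m. K m) x"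
proof -
  define p where "p m = closest_point (K m) x" for m
  define q where "q = closest_point (\<Inter>m. K m) x"
  have clI: "closed (\<Inter>m. K m)" using closed by (intro closed_INT) auto
  have cvI: "convex (\<Inter>m. K m)" using convex by (intro convex_INT) auto
  have neK: "K m \<noteq> {}" for m using ne by auto
  have p: "p m \<in> K m" for m unfolding p_def using closed neK by (rule closest_point_in_set)
  have qI: "q \<in> (\<Inter>m. K m)" unfolding q_def using clI ne by (rule closest_point_in_set)
  have key: "(norm (p m - y))\<^sup>2 \<le> (dist x y)\<^sup>2 - (dist x (p m))\<^sup>2" if "y \<in> K m" for m y
  proof -
    have "(x - p m) \<bullet> (y - p m) \<le> 0"
      unfolding p_def using convex closed that by (rule closest_point_dot)
    then show ?thesis
      by (simp add: dist_norm power2_norm_eq_inner inner_diff_left inner_diff_right inner_commute)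
  qed
  have mono: "(dist x (p m))\<^sup>2 \<le> (dist x (p m'))\<^sup>2" if "m \<le> m'" for m m'
  proof -
    have "p m' \<in> K m" using p[of m'] decseqD[OF dec that] by blast
    then show ?thesis using key[of "p m'" m] by (smt (verit) zero_le_power2)
  qed
  have bound: "(dist x (p m))\<^sup>2 \<le> (dist x q)\<^sup>2" for m
    using key[of q m] qI by (smt (verit) zero_le_power2 INT_iff UNIV_I)
  have "incseq (\<lambda>m. (dist x (p m))\<^sup>2)" using mono by (simp add: incseq_def)
  then obtain d where "(\<lambda>m. (dist x (p m))\<^sup>2) \<longlonglongrightarrow> d"
    using incseq_convergent[of "\<lambda>m. (dist x (p m))\<^sup>2" "(dist x q)\<^sup>2"] bound by blast
  then have cau: "Cauchy (\<lambda>m. (dist x (p m))\<^sup>2)" by (rule LIMSEQ_imp_Cauchy)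
  have "Cauchy p"
    unfolding Cauchy_altdef
  proof (intro allI impI)
    fix e :: real assume e: "e > 0"
    then obtain M where M: "\<And>m n. m \<ge> M \<Longrightarrow> n > m \<Longrightarrow> dist ((dist x (p m))\<^sup>2) ((dist x (p n))\<^sup>2) < e\<^sup>2"
      using cau unfolding Cauchy_altdef by (metis zero_less_power)
    have "dist (p m) (p n) < e" if mn: "m \<ge> M" "n > m" for m n
    proof -
      have "p n \<in> K m" using p[of n] decseqD[OF dec, of m n] mn by auto
      then have "(norm (p m - p n))\<^sup>2 < e\<^sup>2"
        using key[of "p n" m] M[OF mn] by (auto simp: dist_real_def abs_less_iff)
      then show ?thesis using e by (simp add: dist_norm power_less_imp_less_base)
    qed
    then show "\<exists>M. \<forall>m\<ge>M. \<forall>n>m. dist (p m) (p n) < e" by blast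
  qed
  then obtain l where l: "p \<longlonglongrightarrow> l" using Cauchy_convergent convergent_def by blast
  have "l \<in> K m" for m
  proof (rule Lim_in_closed_set[OF closed _ _ l])
    show "\<forall>\<^sub>F n in sequentially. p n \<in> K m"
      using eventually_ge_at_top[of m] by eventually_elim (use p decseqD[OF dec] in blast)
  qed simp
  then have lI: "l \<in> (\<Inter>m. K m)" by blast
  have "dist x l \<le> dist x q"
  proof (rule LIMSEQ_le_const2)
    show "(\<lambda>m. dist x (p m)) \<longlonglongrightarrow> dist x l" by (intro tendsto_intros l)
    show "\<exists>N. \<forall>m\<ge>N. dist x (p m) \<le> dist x q" using bound by simp
  qed
  then have "\<forall>z\<in>(\<Inter>m. K m). dist x l \<le> dist x z"
    using closest_point_le[OF clI, of _ x] order_trans unfolding q_def by blast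
  then have "l = q" unfolding q_def by (rule closest_point_unique[OF cvI clI lI])
  then show ?thesis using l by (simp add: p_def[abs_def] q_def)
qed

text \<open>Finitely many constraints at a time give polyhedral cones decreasing to
  \<open>K\<close>, for which the sum vanishes; dominated convergence at each node carries this over
  to \<open>K\<close>.\<close>

lemma sum_lagrange_gauss_stretch:
  fixes A :: "nat \<Rightarrow> (real^'n::{finite,wellorder}) set"
  assumes A: "\<And>m. finite (A m)" "incseq A" and K: "K = {z. \<forall>a\<in>(\<Union>m. A m). a \<bullet> z \<ge> 0}"
    and k: "k \<in> K" "a \<in> A 0" "a \<bullet> k > 0"
    and S: "finite S" "CARD('n) < card S" "S \<subseteq> {0<..1}"
    and gauss: "integrable lborel (\<lambda>z::real^'n::_. exp (- (norm z)\<^sup>2 / 2))"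
  shows "(\<Sum>t\<in>S. lagrange_weight S t * (\<integral>z. closed_convex_cone.gauss_stretch K t z \<partial>lborel)) = 0"
proof -
  define C where "C m = {z. \<forall>a\<in>A m. a \<bullet> z \<ge> 0}" for m
  have ccc: "closed_convex_cone (C m)" for m unfolding C_def by (rule closed_convex_cone_halfspaces)
  interpret closed_convex_cone K unfolding K by (rule closed_convex_cone_halfspaces)
  have INT: "(\<Inter>m. C m) = K" by (auto simp: K C_def)
  have dec: "decseq C" using A(2) by (auto simp: decseq_def incseq_def C_def)
  have lim: "(\<lambda>m. closed_convex_cone.proj (C m) z) \<longlonglongrightarrow> proj z" for z
    using closest_point_INT_tendsto[of C z] ccc dec nonempty
    unfolding closed_convex_cone.proj_def[OF ccc] proj_def INT
    by (simp add: closed_convex_cone_def)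
  have "(\<lambda>m. \<integral>z. closed_convex_cone.gauss_stretch (C m) t z \<partial>lborel) \<longlonglongrightarrow> (\<integral>z. gauss_stretch t z \<partial>lborel)"
    if t: "t \<in> S" for t
  proof (rule integral_dominated_convergence[where w = "\<lambda>z. exp (- (norm z)\<^sup>2 / 2)"])
    have t01: "0 < t" "t \<le> 1" using t S(3) by auto
    show "AE z in lborel. (\<lambda>m. closed_convex_cone.gauss_stretch (C m) t z) \<longlonglongrightarrow> gauss_stretch t z"
      unfolding closed_convex_cone.gauss_stretch_def[OF ccc] closed_convex_cone.stretch_def[OF ccc]
        gauss_stretch_def stretch_def
      by (intro AE_I2 tendsto_intros lim) auto
    show "AE z in lborel. norm (closed_convex_cone.gauss_stretch (C m) t z) \<le> exp (- (norm z)\<^sup>2 / 2)" for m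
      using closed_convex_cone.gauss_stretch_le[OF ccc t01, of m]
      by (intro AE_I2) (simp add: closed_convex_cone.gauss_stretch_def[OF ccc])
    show "closed_convex_cone.gauss_stretch (C m) t \<in> borel_measurable lborel" for m
      using closed_convex_cone.gauss_stretch_borel[OF ccc] by simp
  qed (use gauss in auto)
  then have "(\<lambda>m. \<Sum>t\<in>S. lagrange_weight S t * (\<integral>z. closed_convex_cone.gauss_stretch (C m) t z \<partial>lborel))
      \<longlonglongrightarrow> (\<Sum>t\<in>S. lagrange_weight S t * (\<integral>z. gauss_stretch t z \<partial>lborel))"
    by (intro tendsto_sum tendsto_mult tendsto_const)
  moreover have "(\<Sum>t\<in>S. lagrange_weight S t * (\<integral>z. closed_convex_cone.gauss_stretch (C m) t z \<partial>lborel)) = 0" for m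
  proof -
    \<comment> \<open>The constraint \<open>a\<close> is present from the start, so
      \<open>a \<bullet> k > 0\<close> keeps \<open>- k\<close> out of every \<open>C m\<close>: no
      approximating cone is a subspace.\<close>
    have k': "k \<in> C m" "- k \<notin> C m"
      using k A(2) incseqD[OF A(2), of 0 m] by (force simp: K C_def)+
    have "(\<Sum>t\<in>S. lagrange_weight S t * (\<integral>z. closed_convex_cone.gauss_stretch (C m) t z \<partial>lborel))
      = (\<Sum>t\<in>S. enn2real (gauss_radial_const DIM(real^'n::_)) * (lagrange_weight S t *
          measure lebesgue {z. norm (closed_convex_cone.stretch (C m) (1 / t) z) < 1}))"
      using S(3) by (intro sum.cong refl) (subst closed_convex_cone.integral_gauss_stretch[OF ccc], simp)
    also have "\<dots> = 0"
      using sum_lagrange_stretch_volume[OF A(1) C_def k' S] by (simp flip: sum_distrib_left)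
    finally show ?thesis .
  qed
  ultimately show ?thesis by (simp add: LIMSEQ_const_iff)
qed

section \<open>Quadratic forms and linear changes of variables\<close>

text \<open>The change of variables formula of the library requires a well-ordered index type; this is
  such a copy of an arbitrary finite type.\<close>

typedef 'a index = "{..<CARD('a::finite)}"
  by (rule exI[of _ 0]) simp

instantiation index :: (finite) wellorder
begin

definition less_eq_index :: "'a index \<Rightarrow> 'a index \<Rightarrow> bool" where
  "less_eq_index i j \<longleftrightarrow> Rep_index i \<le> Rep_index j"

definition less_index :: "'a index \<Rightarrow> 'a index \<Rightarrow> bool" where
  "less_index i j \<longleftrightarrow> Rep_index i < Rep_index j"

instance
proof
  fix P :: "'a index \<Rightarrow> bool" and i
  assume step: "\<And>i. (\<And>j. j < i \<Longrightarrow> P j) \<Longrightarrow> P i"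
  show "P i"
  proof (induction i rule: measure_induct_rule[of Rep_index])
    case (less i)
    show ?case by (rule step, rule less) (simp add: less_index_def)
  qed
qed (auto simp: less_eq_index_def less_index_def Rep_index_inject)

end

lemma card_UNIV_index: "CARD('a index) = CARD('a::finite)"
  using type_definition.card[OF type_definition_index] by simp

instance index :: (finite) finite
proof
  have "(UNIV :: 'a index set) = Abs_index ` {..<CARD('a)}"
    using type_definition.univ[OF type_definition_index] .
  then show "finite (UNIV :: 'a index set)" by (metis finite_imageI finite_lessThan)
qed

lemma quadratic_form_commute:
  assumes "pos_def Q"
  shows "x \<bullet> (Q *v y) = y \<bullet> (Q *v x)"
proof -
  have "x \<bullet> (Q *v y) = (x v* Q) \<bullet> y" by (rule dot_lmul_matrix[symmetric])
  also have "x v* Q = transpose Q *v x" by (rule transpose_matrix_vector[symmetric])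
  also have "transpose Q = Q" using assms by (simp add: pos_def_def)
  finally show ?thesis by (simp only: inner_commute)
qed

text \<open>Gram-Schmidt for the inner product defined by \<open>Q\<close>.\<close>

lemma ex_quadratic_orthonormal_family:
  fixes Q :: "real^'m^'m"
  assumes Q: "pos_def Q"
  shows "n \<le> CARD('m) \<Longrightarrow> \<exists>b :: nat \<Rightarrow> real^'m. \<forall>i<n. \<forall>j<n. b i \<bullet> (Q *v b j) = (if i = j then 1 else 0)"
proof (induction n)
  case 0
  then show ?case by simp
next
  case (Suc n)
  then obtain b :: "nat \<Rightarrow> real^'m" where b: "\<And>i j. i < n \<Longrightarrow> j < n \<Longrightarrow> b i \<bullet> (Q *v b j) = (if i = j then 1 else 0)"
    by auto
  have "dim (b ` {..<n}) \<le> card (b ` {..<n})" by (rule dim_le_card') simp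
  also have "\<dots> \<le> n" using card_image_le[of "{..<n}" b] by simp
  finally have "dim (b ` {..<n}) < DIM(real^'m)" using Suc.prems by simp
  then have "span (b ` {..<n}) \<noteq> UNIV" using dim_eq_full[of "b ` {..<n}"] by simp
  then obtain x where x: "x \<notin> span (b ` {..<n})" by blast
  define y where "y = x - (\<Sum>i<n. (b i \<bullet> (Q *v x)) *\<^sub>R b i)"
  have "(\<Sum>i<n. (b i \<bullet> (Q *v x)) *\<^sub>R b i) \<in> span (b ` {..<n})"
    by (intro span_sum span_scale span_base) auto
  then have "y \<noteq> 0" using x by (auto simp: y_def)
  then have pos: "y \<bullet> (Q *v y) > 0" using Q by (simp add: pos_def_def)
  have orth: "b j \<bullet> (Q *v y) = 0" if "j < n" for j
  proof -
    have "b j \<bullet> (Q *v y) = b j \<bullet> (Q *v x) - (\<Sum>i<n. (b i \<bullet> (Q *v x)) * (b j \<bullet> (Q *v b i)))"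
      by (simp add: y_def matrix_vector_mult_diff_distrib linear_sum[OF matrix_vector_mul_linear]
          matrix_vector_mult_scaleR inner_diff_right inner_sum_right)
    also have "(\<Sum>i<n. (b i \<bullet> (Q *v x)) * (b j \<bullet> (Q *v b i))) = (\<Sum>i<n. if i = j then b j \<bullet> (Q *v x) else 0)"
      using that by (intro sum.cong refl) (simp add: b)
    finally show ?thesis using that by simp
  qed
  define c where "c = y /\<^sub>R sqrt (y \<bullet> (Q *v y))"
  have cc: "c \<bullet> (Q *v c) = 1"
    using pos by (simp add: c_def matrix_vector_mult_scaleR divide_simps)
  have bc: "b j \<bullet> (Q *v c) = 0" "c \<bullet> (Q *v b j) = 0" if "j < n" for j
    using orth[OF that] quadratic_form_commute[OF Q, of c "b j"]
    by (simp_all add: c_def matrix_vector_mult_scaleR)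
  show ?case
    by (rule exI[of _ "b(n := c)"]) (auto simp: less_Suc_eq b bc cc)
qed

text \<open>The coordinate vectors are sent to a \<open>Q\<close>-orthonormal basis. The index type
  \<open>'k\<close> is left open so that it can be the well-ordered copy of
  \<open>'m\<close>.\<close>

lemma ex_quadratic_isometry:
  fixes Q :: "real^'m^'m"
  assumes Q: "pos_def Q" and card: "CARD('k) = CARD('m)"
  obtains A :: "real^'k \<Rightarrow> real^'m" where "linear A" "bij A" "\<And>z. qnorm Q (A z) = norm z"
proof -
  obtain b :: "nat \<Rightarrow> real^'m" where b: "\<And>i j. i < CARD('m) \<Longrightarrow> j < CARD('m) \<Longrightarrow>
      b i \<bullet> (Q *v b j) = (if i = j then 1 else 0)"
    using ex_quadratic_orthonormal_family[OF Q order_refl] by blast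
  obtain \<iota> :: "'k \<Rightarrow> nat" where \<iota>: "bij_betw \<iota> UNIV {..<CARD('m)}"
    using finite_same_card_bij[of "UNIV :: 'k set" "{..<CARD('m)}"] card by auto
  have \<iota>_less: "\<iota> j < CARD('m)" and \<iota>_eq: "\<iota> i = \<iota> j \<longleftrightarrow> i = j" for i j
    using \<iota> by (auto simp: bij_betw_def inj_on_eq_iff)
  define A :: "real^'k \<Rightarrow> real^'m" where "A z = (\<Sum>j\<in>UNIV. z $ j *\<^sub>R b (\<iota> j))" for z
  have lin: "linear A"
    unfolding A_def by (intro linearI) (simp_all add: scaleR_add_left sum.distrib scaleR_sum_right)
  have form: "A z \<bullet> (Q *v A z) = z \<bullet> z" for z
  proof -
    have "A z \<bullet> (Q *v A z) = (\<Sum>i\<in>UNIV. \<Sum>j\<in>UNIV. z $ i * (z $ j * (b (\<iota> j) \<bullet> (Q *v b (\<iota> i)))))"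
      by (simp add: A_def linear_sum[OF matrix_vector_mul_linear] matrix_vector_mult_scaleR
          inner_sum_left inner_sum_right sum_distrib_left)
    also have "\<dots> = (\<Sum>i\<in>UNIV. \<Sum>j\<in>UNIV. if i = j then z $ i * z $ i else 0)"
      by (intro sum.cong refl) (simp add: b \<iota>_less \<iota>_eq)
    also have "\<dots> = z \<bullet> z" by (simp add: inner_vec_def)
    finally show ?thesis .
  qed
  then have iso: "qnorm Q (A z) = norm z" for z by (simp add: qnorm_def norm_eq_sqrt_inner)
  have "inj A"
    unfolding linear_injective_0[OF lin]
  proof (intro allI impI)
    fix z assume "A z = 0"
    then have "z \<bullet> z = 0" using form[of z] by simp
    then show "z = 0" by simp
  qed
  moreover have "surj A"
  proof -
    have "dim (range A) = DIM(real^'k)" using dim_image_eq[OF lin, of UNIV] \<open>inj A\<close> by simp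
    then have "dim (range A) = DIM(real^'m)" using card by simp
    then have "span (range A) = UNIV" by (simp only: dim_eq_full)
    then show ?thesis using linear_subspace_image[OF lin subspace_UNIV] by (metis span_eq_iff)
  qed
  ultimately show ?thesis using that lin iso by (auto simp: bij_def)
qed

text \<open>The index types differ, so \<open>R\<close> renames coordinates to make
  \<open>R \<circ> A\<close> a map of one space into itself; \<open>\<kappa>\<close> is the absolute
  value of its determinant. Lebesgue measure is recognised by its values on boxes.\<close>

lemma nn_integral_lborel_linear_bij:
  fixes A :: "real^'k::{finite,wellorder} \<Rightarrow> real^'m"
  assumes A: "linear A" "bij A" and card: "CARD('k) = CARD('m)"
  obtains \<kappa> :: real where "\<kappa> > 0"
    "\<And>f. f \<in> borel_measurable borel \<Longrightarrow>
      (\<integral>\<^sup>+c. f c \<partial>lborel) = ennreal \<kappa> * (\<integral>\<^sup>+z. f (A z) \<partial>lborel)"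
proof -
  obtain \<phi> :: "'m \<Rightarrow> 'k" where \<phi>: "bij \<phi>"
    using finite_same_card_bij[of "UNIV :: 'm set" "UNIV :: 'k set"] card by auto
  define R where "R c = (\<chi> j. c $ inv \<phi> j)" for c :: "real^'m"
  have lin: "linear (R \<circ> A)"
    unfolding R_def by (intro linear_compose[OF A(1)] linearI) (simp_all add: vec_eq_iff)
  have "inj R"
  proof (rule injI)
    fix c d assume eq: "R c = R d"
    have "c $ i = d $ i" for i
      using arg_cong[OF eq, of "\<lambda>z. z $ \<phi> i"] \<phi> by (simp add: R_def bij_def inv_f_f)
    then show "c = d" by (simp add: vec_eq_iff)
  qed
  moreover have "inj A" using A(2) by (rule bij_is_inj)
  ultimately have inj: "inj (R \<circ> A)" by (rule inj_compose)
  define \<kappa> where "\<kappa> = \<bar>det (matrix (R \<circ> A))\<bar>"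
  have \<kappa>: "\<kappa> > 0" using inj det_nz_iff_inj[OF lin] by (simp add: \<kappa>_def)
  have [measurable]: "A \<in> borel_measurable borel"
    using linear_continuous_on[OF linear_conv_bounded_linear[THEN iffD1, OF A(1)]]
    by (rule borel_measurable_continuous_onI)
  let ?M = "density (distr lborel borel A) (\<lambda>_. ennreal \<kappa>)"
  have lborel_eq: "lborel = ?M"
  proof (rule lborel_eqI)
    fix l u :: "real^'m"
    assume lu: "\<And>b. b \<in> Basis \<Longrightarrow> l \<bullet> b \<le> u \<bullet> b"
    have image: "(R \<circ> A) ` (A -` box l u) = box (R l) (R u)"
    proof (intro equalityI subsetI)
      fix z assume "z \<in> (R \<circ> A) ` (A -` box l u)"
      then show "z \<in> box (R l) (R u)" by (auto simp: R_def mem_box_cart)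
    next
      fix z assume z: "z \<in> box (R l) (R u)"
      define c where "c = (\<chi> i. z $ \<phi> i)"
      have "R c = z" using \<phi> by (simp add: R_def c_def vec_eq_iff bij_def surj_f_inv_f)
      have "l $ i < c $ i \<and> c $ i < u $ i" for i
        using z[unfolded mem_box_cart, rule_format, of "\<phi> i"] \<phi> by (simp add: c_def R_def bij_def inv_f_f)
      then have "c \<in> box l u" by (simp add: mem_box_cart)
      moreover obtain x where "A x = c" using A(2) by (metis bij_pointE)
      ultimately show "z \<in> (R \<circ> A) ` (A -` box l u)"
        using \<open>R c = z\<close> by (intro image_eqI[of _ _ x]) auto
    qed
    have S: "A -` box l u \<in> sets borel" using measurable_sets_borel[of A borel "box l u"] by simp
    have "bounded (A -` box l u)"
    proof -
      obtain B where B: "linear B" "B \<circ> A = id" using linear_injective_left_inverse[OF A(1) \<open>inj A\<close>] by blast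
      have "A -` box l u \<subseteq> B ` box l u"
      proof
        fix x assume "x \<in> A -` box l u"
        then show "x \<in> B ` box l u" using fun_cong[OF B(2), of x] by (intro image_eqI[of _ _ "A x"]) auto
      qed
      moreover have "bounded (B ` box l u)"
        using B(1) by (intro bounded_linear_image bounded_box) (simp add: linear_conv_bounded_linear)
      ultimately show ?thesis by (rule bounded_subset[rotated])
    qed
    with S have lm: "A -` box l u \<in> lmeasurable" by (simp add: bounded_set_imp_lmeasurable)
    have fin: "emeasure lborel (A -` box l u) < \<infinity>"
      using \<open>bounded (A -` box l u)\<close> by (rule emeasure_bounded_finite)
    have "emeasure ?M (box l u) = ennreal \<kappa> * emeasure lborel (A -` box l u)"
      by (simp add: emeasure_density nn_integral_distr nn_integral_cmult_indicator nn_integral_cmult emeasure_distr)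
    also have "\<dots> = ennreal (\<kappa> * measure lebesgue (A -` box l u))"
      using fin \<kappa> S by (simp add: emeasure_eq_ennreal_measure ennreal_mult less_top[symmetric])
    also have "\<kappa> * measure lebesgue (A -` box l u) = measure lebesgue (box (R l) (R u))"
      unfolding \<kappa>_def by (simp only: measure_linear_image[OF lin lm, symmetric] image)
    also have "\<dots> = (\<Prod>j\<in>UNIV. (u - l) $ inv \<phi> j)"
    proof -
      have "l $ i \<le> u $ i" for i using lu[of "axis i 1"] by (simp add: inner_axis)
      then have "\<forall>b\<in>Basis. R l \<bullet> b \<le> R u \<bullet> b"
        by (auto simp: Basis_vec_def R_def inner_axis)
      then have "measure lebesgue (box (R l) (R u)) = (\<Prod>b\<in>Basis. (R u - R l) \<bullet> b)"
        by (simp add: measure_lborel_box inner_diff_left)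
      also have "\<dots> = (\<Prod>j\<in>UNIV. (u - l) $ inv \<phi> j)"
        by (simp add: Basis_vec_def UNION_singleton_eq_range prod.reindex inj_on_def axis_eq_axis inner_axis R_def)
      finally show ?thesis .
    qed
    also have "\<dots> = (\<Prod>i\<in>UNIV. (u - l) $ i)"
      using \<phi> by (intro prod.reindex_bij_betw bij_imp_bij_inv)
    also have "\<dots> = (\<Prod>b\<in>Basis. (u - l) \<bullet> b)"
      by (simp add: Basis_vec_def UNION_singleton_eq_range prod.reindex inj_on_def axis_eq_axis inner_axis)
    finally show "emeasure ?M (box l u) = ennreal (\<Prod>b\<in>Basis. (u - l) \<bullet> b)" .
  qed simp
  have "(\<integral>\<^sup>+c. f c \<partial>lborel) = ennreal \<kappa> * (\<integral>\<^sup>+z. f (A z) \<partial>lborel)"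
    if [measurable]: "f \<in> borel_measurable borel" for f
    by (subst lborel_eq) (simp add: nn_integral_density nn_integral_distr nn_integral_cmult)
  with \<kappa> show ?thesis using that by blast
qed

section \<open>Chi-square laws and their Laplace transforms\<close>

text \<open>\<open>1 - exp (- r * X)\<close> is the integral of \<open>r * exp (- r * y)\<close>
  over \<open>0 < y \<le> X\<close>, and Fubini exchanges it with the expectation. Formulas for
  tails thereby become formulas for Laplace transforms.\<close>

lemma (in prob_space) laplace_tail:
  assumes X [measurable]: "X \<in> borel_measurable M" and nonneg: "\<And>\<omega>. \<omega> \<in> space M \<Longrightarrow> X \<omega> \<ge> 0"
    and r: "r > 0"
  shows "integrable lborel (\<lambda>y. indicator {0<..} y * (r * exp (- r * y)) * \<P>(\<omega> in M. X \<omega> \<ge> y))"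
    and "(\<integral>y. indicator {0<..} y * (r * exp (- r * y)) * \<P>(\<omega> in M. X \<omega> \<ge> y) \<partial>lborel)
      = 1 - (\<integral>\<omega>. exp (- r * X \<omega>) \<partial>M)"
proof -
  interpret pair_sigma_finite M "lborel :: real measure"
    by (intro pair_sigma_finite.intro sigma_finite_measure_axioms sigma_finite_lborel)
  let ?g = "\<lambda>y. indicator {0<..} y * (r * exp (- r * y)) * \<P>(\<omega> in M. X \<omega> \<ge> y)"
  \<comment> \<open>Measurability of the tail function comes from its monotonicity.\<close>
  have "mono (\<lambda>y. - \<P>(\<omega> in M. X \<omega> \<ge> y))"
    by (intro monoI) (auto intro!: finite_measure_mono)
  then have "(\<lambda>y. - (- \<P>(\<omega> in M. X \<omega> \<ge> y))) \<in> borel_measurable borel"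
    by (intro borel_measurable_uminus borel_measurable_mono)
  then have [measurable]: "(\<lambda>y. \<P>(\<omega> in M. X \<omega> \<ge> y)) \<in> borel_measurable borel" by simp
  have g [measurable]: "?g \<in> borel_measurable lborel" by measurable
  have g_nonneg: "?g y \<ge> 0" for y using r by (simp add: indicator_def)
  have inner: "(\<integral>\<^sup>+y. (if 0 < y \<and> y \<le> c then ennreal (r * exp (- r * y)) else 0) \<partial>lborel)
      = ennreal (1 - exp (- r * c))" if "c \<ge> 0" for c
  proof -
    have "(\<integral>\<^sup>+y. ennreal (r * exp (- r * y)) * indicator {0..c} y \<partial>lborel)
        = ennreal (- exp (- r * c) - (- exp (- r * 0)))"
      using that r by (intro nn_integral_FTC_Icc) (auto intro!: derivative_eq_intros)
    moreover have "(\<integral>\<^sup>+y. ennreal (r * exp (- r * y)) * indicator {0..c} y \<partial>lborel)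
        = (\<integral>\<^sup>+y. (if 0 < y \<and> y \<le> c then ennreal (r * exp (- r * y)) else 0) \<partial>lborel)"
      using AE_lborel_singleton[of "0 :: real"]
      by (intro nn_integral_cong_AE, eventually_elim) (auto simp: indicator_def)
    ultimately show ?thesis by simp
  qed
  have "(\<integral>\<^sup>+y. ennreal (?g y) \<partial>lborel)
      = (\<integral>\<^sup>+y. (\<integral>\<^sup>+\<omega>. (if 0 < y \<and> y \<le> X \<omega> then ennreal (r * exp (- r * y)) else 0) \<partial>M) \<partial>lborel)"
  proof (rule nn_integral_cong)
    fix y :: real
    have "(\<integral>\<^sup>+\<omega>. (if 0 < y \<and> y \<le> X \<omega> then ennreal (r * exp (- r * y)) else 0) \<partial>M)
        = (\<integral>\<^sup>+\<omega>. ennreal (indicator {0<..} y * (r * exp (- r * y))) * indicator {\<omega>\<in>space M. X \<omega> \<ge> y} \<omega> \<partial>M)"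
      by (intro nn_integral_cong) (auto simp: indicator_def)
    also have "\<dots> = ennreal (indicator {0<..} y * (r * exp (- r * y))) * ennreal (\<P>(\<omega> in M. X \<omega> \<ge> y))"
      by (subst nn_integral_cmult_indicator) (auto simp: emeasure_eq_measure)
    also have "\<dots> = ennreal (?g y)" using r by (intro ennreal_mult[symmetric]) auto
    finally show "ennreal (?g y) = (\<integral>\<^sup>+\<omega>. (if 0 < y \<and> y \<le> X \<omega> then ennreal (r * exp (- r * y)) else 0) \<partial>M)"
      by (rule sym)
  qed
  also have "\<dots> = (\<integral>\<^sup>+\<omega>. (\<integral>\<^sup>+y. (if 0 < y \<and> y \<le> X \<omega> then ennreal (r * exp (- r * y)) else 0) \<partial>lborel) \<partial>M)"
    by (rule Fubini') measurable
  also have "\<dots> = (\<integral>\<^sup>+\<omega>. ennreal (1 - exp (- r * X \<omega>)) \<partial>M)"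
    using nonneg by (intro nn_integral_cong) (simp only: inner)
  also have "\<dots> = ennreal (\<integral>\<omega>. 1 - exp (- r * X \<omega>) \<partial>M)"
  proof (rule nn_integral_eq_integral)
    show "integrable M (\<lambda>\<omega>. 1 - exp (- r * X \<omega>))"
      by (rule integrable_const_bound[of _ 1]) (use nonneg r in \<open>auto simp: abs_le_iff\<close>)
    show "AE \<omega> in M. 0 \<le> 1 - exp (- r * X \<omega>)" using nonneg r by (intro AE_I2) simp
  qed
  finally have nn: "(\<integral>\<^sup>+y. ennreal (?g y) \<partial>lborel) = ennreal (\<integral>\<omega>. 1 - exp (- r * X \<omega>) \<partial>M)" .
  show "integrable lborel ?g"
    using nn g_nonneg by (intro integrableI_nn_integral_finite[OF g]) auto
  have "(\<integral>y. ?g y \<partial>lborel) = enn2real (\<integral>\<^sup>+y. ennreal (?g y) \<partial>lborel)"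
    using g_nonneg by (intro integral_eq_nn_integral[OF g]) simp
  also have "\<dots> = (\<integral>\<omega>. 1 - exp (- r * X \<omega>) \<partial>M)"
    unfolding nn using nonneg r by (intro enn2real_ennreal integral_nonneg_AE AE_I2) simp
  also have "\<dots> = 1 - (\<integral>\<omega>. exp (- r * X \<omega>) \<partial>M)"
  proof -
    have "integrable M (\<lambda>\<omega>. exp (- r * X \<omega>))"
      by (rule integrable_const_bound[of _ 1]) (use nonneg r in auto)
    then show ?thesis by (simp add: prob_space)
  qed
  finally show "(\<integral>y. ?g y \<partial>lborel) = 1 - (\<integral>\<omega>. exp (- r * X \<omega>) \<partial>M)" .
qed

abbreviation std_normal :: "real measure" where
  "std_normal \<equiv> density lborel (\<lambda>t. ennreal (std_normal_density t))"

abbreviation std_normals :: "nat \<Rightarrow> (nat \<Rightarrow> real) measure" where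
  "std_normals k \<equiv> Pi\<^sub>M {..<k} (\<lambda>_. std_normal)"

lemma prob_space_std_normal: "prob_space std_normal"
  by (rule prob_space_normal_density) simp

lemma prob_space_std_normals: "prob_space (std_normals k)"
  by (intro prob_space_PiM prob_space_std_normal)

lemma sum_squares_measurable [measurable]: "(\<lambda>z. \<Sum>j<k. (z j)\<^sup>2) \<in> borel_measurable (std_normals k)"
  by measurable

text \<open>For \<open>k = 0\<close> the empty sum is 0, in agreement with the separate case of the
  definition.\<close>

lemma chi_square_upper_eq: "chi_square_upper k x = \<P>(z in std_normals k. (\<Sum>j<k. (z j)\<^sup>2) \<ge> x)"
proof -
  interpret prob_space "std_normals k" by (rule prob_space_std_normals)
  show ?thesis
  proof (cases "k = 0")
    case True
    have "{z \<in> space (std_normals k). (\<Sum>j<k. (z j)\<^sup>2) \<ge> x} = (if x \<le> 0 then space (std_normals k) else {})"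
      using True by auto
    then show ?thesis using True prob_space by (simp add: chi_square_upper_def)
  next
    case False
    then show ?thesis
      by (simp add: chi_square_upper_def chi_square_def measure_distr vimage_def Int_def conj_commute)
  qed
qed

lemma chi_square_upper_nonpos: "x \<le> 0 \<Longrightarrow> chi_square_upper k x = 1"
proof -
  assume x: "x \<le> 0"
  interpret prob_space "std_normals k" by (rule prob_space_std_normals)
  have "(\<Sum>j<k. (z j)\<^sup>2) \<ge> x" for z :: "nat \<Rightarrow> real"
    using x sum_nonneg[of "{..<k}" "\<lambda>j. (z j)\<^sup>2"] by simp
  then show ?thesis using prob_space by (simp add: chi_square_upper_eq)
qed

text \<open>Coupling: the first \<open>k\<close> of \<open>l\<close> independent normals give the
  smaller sum of squares on the same space.\<close>

lemma chi_square_upper_mono: "k \<le> l \<Longrightarrow> chi_square_upper k x \<le> chi_square_upper l x"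
proof -
  assume kl: "k \<le> l"
  interpret prob_space "std_normals l" by (rule prob_space_std_normals)
  interpret P: product_prob_space "\<lambda>_ :: nat. std_normal" "{..<l}"
    by (intro product_prob_spaceI prob_space_std_normal)
  have S: "{z \<in> space (std_normals k). (\<Sum>j<k. (z j)\<^sup>2) \<ge> x} \<in> sets (std_normals k)"
    by measurable
  have R: "(\<lambda>z. restrict z {..<k}) \<in> measurable (std_normals l) (std_normals k)"
    using kl by (intro measurable_restrict_subset) auto
  have "std_normals k = distr (std_normals l) (std_normals k) (\<lambda>z. restrict z {..<k})"
    using kl by (intro P.distr_restrict) auto
  then have "chi_square_upper k x = measure (distr (std_normals l) (std_normals k) (\<lambda>z. restrict z {..<k}))
      {z \<in> space (std_normals k). (\<Sum>j<k. (z j)\<^sup>2) \<ge> x}"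
    by (simp add: chi_square_upper_eq)
  also have "\<dots> = \<P>(z in std_normals l. (\<Sum>j<k. (z j)\<^sup>2) \<ge> x)"
    using kl by (subst measure_distr[OF R S])
      (auto intro!: arg_cong[where f = "measure _"] simp: space_PiM PiE_def)
  also have "\<dots> \<le> chi_square_upper l x"
    unfolding chi_square_upper_eq
  proof (rule finite_measure_mono)
    show "{z \<in> space (std_normals l). (\<Sum>j<k. (z j)\<^sup>2) \<ge> x} \<subseteq> {z \<in> space (std_normals l). (\<Sum>j<l. (z j)\<^sup>2) \<ge> x}"
    proof safe
      fix z :: "nat \<Rightarrow> real" assume "x \<le> (\<Sum>j<k. (z j)\<^sup>2)"
      also have "\<dots> \<le> (\<Sum>j<l. (z j)\<^sup>2)" using kl by (intro sum_mono2) auto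
      finally show "x \<le> (\<Sum>j<l. (z j)\<^sup>2)" .
    qed
  qed measurable
  finally show ?thesis .
qed

text \<open>Against Lebesgue measure the integrand is \<open>s\<close> times the normal density with
  standard deviation \<open>s = 1 / sqrt (1 + 2 * r)\<close>.\<close>

lemma laplace_std_normal_square:
  assumes r: "r > 0"
  shows "(\<integral>x. exp (- r * x\<^sup>2) \<partial>std_normal) = 1 / sqrt (1 + 2 * r)"
proof -
  define s where "s = 1 / sqrt (1 + 2 * r)"
  have s: "s > 0" "s\<^sup>2 = 1 / (1 + 2 * r)" using r by (auto simp: s_def power_divide)
  have "std_normal_density x * exp (- r * x\<^sup>2) = s * normal_density 0 s x" for x
  proof -
    have "exp (- x\<^sup>2 / 2) * exp (- r * x\<^sup>2) = exp (- x\<^sup>2 / (2 * s\<^sup>2))"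
      using r by (simp add: s(2) flip: exp_add) (simp add: field_simps)
    moreover have "sqrt (2 * pi * s\<^sup>2) = s * sqrt (2 * pi)"
      using s(1) by (simp add: real_sqrt_mult)
    ultimately show ?thesis
      using s(1) by (simp add: std_normal_density_def normal_density_def)
  qed
  then have "(\<integral>x. exp (- r * x\<^sup>2) \<partial>std_normal) = (\<integral>x. s * normal_density 0 s x \<partial>lborel)"
    by (subst integral_density) auto
  also have "\<dots> = s" using s(1) by simp
  finally show ?thesis by (simp add: s_def)
qed

lemma laplace_chi_square:
  assumes r: "r > 0"
  shows "(\<integral>z. exp (- r * (\<Sum>j<k. (z j)\<^sup>2)) \<partial>std_normals k) = (1 / sqrt (1 + 2 * r)) ^ k"
proof -
  interpret N: prob_space std_normal by (rule prob_space_std_normal)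
  interpret product_sigma_finite "\<lambda>_ :: nat. std_normal"
    by unfold_locales
  have "exp (- r * (\<Sum>j<k. (z j)\<^sup>2)) = (\<Prod>j<k. exp (- r * (z j)\<^sup>2))" for z :: "nat \<Rightarrow> real"
    by (simp add: sum_distrib_left exp_sum)
  moreover have "integrable std_normal (\<lambda>x. exp (- r * x\<^sup>2))"
    by (rule N.integrable_const_bound[of _ 1]) (use r in auto)
  ultimately show ?thesis
    using product_integral_prod[of "{..<k}" "\<lambda>_ x. exp (- r * x\<^sup>2)"] laplace_std_normal_square[OF r] by simp
qed

section \<open>The normal law and the cone of nonnegative polynomials\<close>

text \<open>Integrate the mixture of tails against \<open>r * exp (- r * y)\<close> over
  \<open>y > 0\<close>; the constant terms cancel because the weights sum to 1.\<close>

lemma (in prob_space) laplace_chi_square_mixture: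
  assumes X: "X \<in> borel_measurable M" and nonneg: "\<And>\<omega>. \<omega> \<in> space M \<Longrightarrow> X \<omega> \<ge> 0"
    and r: "r > 0" and w: "(\<Sum>i\<in>I. w i) = 1"
    and mixture: "\<And>y. \<P>(\<omega> in M. X \<omega> \<ge> y) = (\<Sum>i\<in>I. w i * chi_square_upper (d i) y)"
  shows "(\<integral>\<omega>. exp (- r * X \<omega>) \<partial>M) = (\<Sum>i\<in>I. w i * (1 / sqrt (1 + 2 * r)) ^ d i)"
proof -
  let ?e = "\<lambda>y. indicator {0<..} y * (r * exp (- r * y)) :: real"
  have chi: "integrable lborel (\<lambda>y. ?e y * chi_square_upper k y)"
    "(\<integral>y. ?e y * chi_square_upper k y \<partial>lborel) = 1 - (1 / sqrt (1 + 2 * r)) ^ k" for k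
    unfolding chi_square_upper_eq laplace_chi_square[OF r, symmetric]
    by (rule prob_space.laplace_tail[OF prob_space_std_normals sum_squares_measurable _ r],
        simp add: sum_nonneg)+
  have "1 - (\<integral>\<omega>. exp (- r * X \<omega>) \<partial>M) = (\<integral>y. ?e y * \<P>(\<omega> in M. X \<omega> \<ge> y) \<partial>lborel)"
    by (rule laplace_tail(2)[OF X nonneg r, symmetric])
  also have "\<dots> = (\<integral>y. (\<Sum>i\<in>I. w i * (?e y * chi_square_upper (d i) y)) \<partial>lborel)"
    unfolding mixture sum_distrib_left by (intro Bochner_Integration.integral_cong sum.cong refl) simp
  also have "\<dots> = (\<Sum>i\<in>I. w i * (1 - (1 / sqrt (1 + 2 * r)) ^ d i))"
    using chi by (subst Bochner_Integration.integral_sum) auto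
  also have "\<dots> = 1 - (\<Sum>i\<in>I. w i * (1 / sqrt (1 + 2 * r)) ^ d i)"
    by (simp add: right_diff_distrib sum_subtractf w)
  finally show ?thesis by simp
qed

lemma pos_def_matrix_inv:
  assumes S: "pos_def S"
  shows "pos_def (matrix_inv S)"
proof -
  have "inj ((*v) S)"
    unfolding linear_injective_0[OF matrix_vector_mul_linear]
    using S by (metis inner_zero_right less_irrefl pos_def_def)
  then have inv: "invertible S"
    using invertible_left_inverse matrix_left_invertible_injective by blast
  have right: "S ** matrix_inv S = mat 1"
    using inv unfolding invertible_def matrix_inv_def by (rule someI2_ex) simp
  have cancel: "S *v (matrix_inv S *v x) = x" for x
    using right by (simp add: matrix_vector_mul_assoc)
  have "transpose (matrix_inv S) = matrix_inv S"
  proof -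
    have "transpose (matrix_inv S) ** S = mat 1"
      using right S by (metis matrix_transpose_mul pos_def_def transpose_mat)
    then have "transpose (matrix_inv S) ** (S ** matrix_inv S) = matrix_inv S"
      by (simp add: matrix_mul_assoc)
    then show ?thesis by (simp add: right)
  qed
  moreover have "x \<bullet> (matrix_inv S *v x) > 0" if "x \<noteq> 0" for x
  proof -
    have "matrix_inv S *v x \<noteq> 0" using that cancel[of x] by (metis matrix_vector_mult_0_right)
    then have "(matrix_inv S *v x) \<bullet> (S *v (matrix_inv S *v x)) > 0" using S by (simp add: pos_def_def)
    then show ?thesis by (simp add: cancel inner_commute)
  qed
  ultimately show ?thesis by (simp add: pos_def_def)
qed

text \<open>Since \<open>qproj\<close> picks some minimiser by choice, uniqueness matters: being a
  minimiser is shown equivalent to being \<open>A (proj z)\<close>.\<close>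

lemma qproj_isometry:
  fixes A :: "real^'k \<Rightarrow> real^'m"
  assumes A: "linear A" "bij A" and iso: "\<And>z. qnorm Q (A z) = norm z"
    and ccc: "closed_convex_cone {z. A z \<in> K}"
  shows "qproj Q (A z) K = A (closed_convex_cone.proj {z. A z \<in> K} z)"
proof -
  interpret closed_convex_cone "{z. A z \<in> K}" by fact
  have dist: "qnorm Q (A z - A y) = dist z y" for y
    by (simp add: iso dist_norm flip: linear_diff[OF A(1)])
  have min: "is_arg_min (\<lambda>y. qnorm Q (A z - y)) (\<lambda>y. y \<in> K) y \<longleftrightarrow> y = A (proj z)" for y
  proof
    assume arg: "is_arg_min (\<lambda>y. qnorm Q (A z - y)) (\<lambda>y. y \<in> K) y"
    obtain x where x: "y = A x" using A(2) by (metis bij_pointE)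
    have "\<forall>k\<in>{z. A z \<in> K}. dist z x \<le> dist z k"
      using arg by (auto simp: is_arg_min_linorder x dist)
    moreover have "x \<in> {z. A z \<in> K}" using arg by (simp add: is_arg_min_def x)
    ultimately have "x = proj z"
      unfolding proj_def using closed convex closest_point_unique by blast
    then show "y = A (proj z)" by (simp add: x)
  next
    assume y: "y = A (proj z)"
    have "dist z (proj z) \<le> dist z x" if "A x \<in> K" for x
      unfolding proj_def using closed that by (intro closest_point_le) auto
    have "qnorm Q (A z - A (proj z)) \<le> qnorm Q (A z - k)" if "k \<in> K" for k
    proof -
      obtain x where x: "k = A x" using A(2) by (metis bij_pointE)
      show ?thesis using \<open>\<And>x. A x \<in> K \<Longrightarrow> dist z (proj z) \<le> dist z x\<close>[of x] that by (simp only: x dist)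
    qed
    moreover have "A (proj z) \<in> K" using proj_in[of z] by simp
    ultimately show "is_arg_min (\<lambda>y. qnorm Q (A z - y)) (\<lambda>y. y \<in> K) y"
      unfolding is_arg_min_linorder y by blast
  qed
  show ?thesis
    unfolding qproj_def arg_min_on_def arg_min_def min by (rule some_eq_trivial)
qed

lemma lambda12_isometry:
  fixes A :: "real^'k \<Rightarrow> real^'m"
  assumes "linear A" "bij A" "\<And>z. qnorm (matrix_inv \<Sigma>) (A z) = norm z"
    and ccc: "closed_convex_cone {z. A z \<in> K}"
  shows "lambda12 \<Sigma> K (A z) = (norm (z - closed_convex_cone.proj {z. A z \<in> K} z))\<^sup>2"
  using closed_convex_cone.pythagoras[OF ccc, of z]
  by (simp add: lambda12_def lambda01_def qproj_isometry[OF assms] assms(3))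

text \<open>In the coordinates \<open>z\<close> the density is a constant times
  \<open>exp (- (norm z)^2 / 2)\<close>; \<open>C\<close> combines this constant with the volume
  factor of \<open>A\<close>.\<close>

lemma mvn_nn_integral_isometry:
  fixes A :: "real^'k::{finite,wellorder} \<Rightarrow> real^'m"
  assumes A: "linear A" "bij A" "\<And>z. qnorm (matrix_inv \<Sigma>) (A z) = norm z"
    and Sigma: "pos_def \<Sigma>" and card: "CARD('k) = CARD('m)" and M: "prob_space M"
    and X: "distributed M lborel X (\<lambda>c. ennreal (mvn_density 0 \<Sigma> c))"
  obtains C :: real where "C > 0"
    "\<And>g. g \<in> borel_measurable borel \<Longrightarrow> (\<integral>\<^sup>+\<omega>. g (X \<omega>) \<partial>M) =
      ennreal C * (\<integral>\<^sup>+z. ennreal (exp (- (norm z)\<^sup>2 / 2)) * g (A z) \<partial>lborel)"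
proof -
  define c where "c = 1 / sqrt ((2 * pi) ^ CARD('m) * det \<Sigma>)"
  have dens_A: "mvn_density 0 \<Sigma> (A z) = c * exp (- (norm z)\<^sup>2 / 2)" for z
  proof -
    have "A z \<bullet> (matrix_inv \<Sigma> *v A z) = (qnorm (matrix_inv \<Sigma>) (A z))\<^sup>2"
      using pos_def_matrix_inv[OF Sigma] unfolding qnorm_def pos_def_def
      by (cases "A z = 0") (simp_all add: less_imp_le)
    then show ?thesis by (simp add: mvn_density_def c_def A(3))
  qed
  obtain \<kappa> where \<kappa>: "\<kappa> > 0" "\<And>f. f \<in> borel_measurable borel \<Longrightarrow>
      (\<integral>\<^sup>+c. f c \<partial>lborel) = ennreal \<kappa> * (\<integral>\<^sup>+z. f (A z) \<partial>lborel)"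
    using nn_integral_lborel_linear_bij[OF A(1,2) card] by blast
  have [measurable]: "(\<lambda>c. ennreal (mvn_density 0 \<Sigma> c)) \<in> borel_measurable borel"
    using distributed_borel_measurable[OF X] by simp
  have [measurable]: "A \<in> borel_measurable borel"
    using linear_continuous_on[OF linear_conv_bounded_linear[THEN iffD1, OF A(1)]]
    by (rule borel_measurable_continuous_onI)
  have transfer: "(\<integral>\<^sup>+\<omega>. g (X \<omega>) \<partial>M) =
      ennreal (\<kappa> * c) * (\<integral>\<^sup>+z. ennreal (exp (- (norm z)\<^sup>2 / 2)) * g (A z) \<partial>lborel)"
    if [measurable]: "g \<in> borel_measurable borel" for g
  proof -
    have "(\<integral>\<^sup>+\<omega>. g (X \<omega>) \<partial>M) = (\<integral>\<^sup>+c. ennreal (mvn_density 0 \<Sigma> c) * g c \<partial>lborel)"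
      by (rule distributed_nn_integral[OF X, symmetric]) simp
    also have "\<dots> = ennreal \<kappa> * (\<integral>\<^sup>+z. ennreal (mvn_density 0 \<Sigma> (A z)) * g (A z) \<partial>lborel)"
      by (rule \<kappa>(2)) measurable
    also have "(\<integral>\<^sup>+z. ennreal (mvn_density 0 \<Sigma> (A z)) * g (A z) \<partial>lborel)
        = (\<integral>\<^sup>+z. ennreal c * (ennreal (exp (- (norm z)\<^sup>2 / 2)) * g (A z)) \<partial>lborel)"
      by (intro nn_integral_cong) (simp add: dens_A ennreal_mult'' mult.assoc)
    also have "\<dots> = ennreal c * (\<integral>\<^sup>+z. ennreal (exp (- (norm z)\<^sup>2 / 2)) * g (A z) \<partial>lborel)"
      by (rule nn_integral_cmult) measurable
    finally show ?thesis using \<kappa>(1) by (simp add: ennreal_mult' mult.assoc)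
  qed
  \<comment> \<open>Positivity is read off from the total mass 1, taking
    \<open>g = 1\<close>.\<close>
  have "\<kappa> * c > 0"
  proof (rule ccontr)
    assume "\<not> \<kappa> * c > 0"
    then have "ennreal (\<kappa> * c) = 0" by (simp add: ennreal_neg)
    then show False using transfer[of "\<lambda>_. 1"] prob_space.emeasure_space_1[OF M] by simp
  qed
  with transfer show ?thesis using that by blast
qed

text \<open>By continuity, nonnegativity on a countable dense subset of \<open>T\<close> suffices.
  Its enumeration gives increasing finite sets of constraints, and the adjoint rewrites each
  constraint as a half-space in \<open>z\<close>.\<close>

lemma nonneg_poly_cone_preimage:
  fixes A :: "real^'k \<Rightarrow> real^'m"
  assumes A: "linear A" and T: "T \<noteq> {}"
  obtains D :: "nat \<Rightarrow> real set" where "\<And>m. finite (D m)" "incseq D" "D 0 \<noteq> {}" "D 0 \<subseteq> T"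
    "{z. A z \<in> nonneg_poly_cone e T} =
      {z. \<forall>a\<in>(\<Union>m. (\<lambda>t. adjoint A (monomial_vec e t)) ` D m). a \<bullet> z \<ge> 0}"
proof -
  obtain D' where D': "countable D'" "D' \<subseteq> T" "T \<subseteq> closure D'"
    using separable[of T] by blast
  have ne: "D' \<noteq> {}" using D'(3) T by auto
  define D where "D m = from_nat_into D' ` {..m}" for m
  have UN: "(\<Union>m. D m) = D'"
  proof -
    have "(\<Union>m. D m) = range (from_nat_into D')" unfolding D_def by auto
    then show ?thesis using range_from_nat_into[OF ne D'(1)] by simp
  qed
  have inner: "adjoint A (monomial_vec e t) \<bullet> z = A z \<bullet> monomial_vec e t" for z t
    using adjoint_works[OF A] by (simp add: inner_commute)
  have dense: "(\<forall>t\<in>T. c \<bullet> monomial_vec e t \<ge> 0) \<longleftrightarrow> (\<forall>t\<in>D'. c \<bullet> monomial_vec e t \<ge> 0)" for c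
  proof
    assume pos: "\<forall>t\<in>D'. c \<bullet> monomial_vec e t \<ge> 0"
    have "continuous_on UNIV (\<lambda>t. c \<bullet> monomial_vec e t)"
      unfolding monomial_vec_def by (intro continuous_intros)
    then have "closed {t. 0 \<le> c \<bullet> monomial_vec e t}"
      by (intro closed_Collect_le continuous_on_const)
    moreover have "D' \<subseteq> {t. 0 \<le> c \<bullet> monomial_vec e t}" using pos by auto
    ultimately have "closure D' \<subseteq> {t. 0 \<le> c \<bullet> monomial_vec e t}" by (rule closure_minimal[rotated])
    then show "\<forall>t\<in>T. c \<bullet> monomial_vec e t \<ge> 0" using D'(3) by auto
  qed (use D'(2) in auto)
  have eq: "{z. A z \<in> nonneg_poly_cone e T} =
      {z. \<forall>a\<in>(\<Union>m. (\<lambda>t. adjoint A (monomial_vec e t)) ` D m). a \<bullet> z \<ge> 0}"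
  proof -
    have "{z. A z \<in> nonneg_poly_cone e T} = {z. \<forall>t\<in>(\<Union>m. D m). A z \<bullet> monomial_vec e t \<ge> 0}"
      unfolding nonneg_poly_cone_def mem_Collect_eq dense UN ..
    then show ?thesis by (simp add: inner)
  qed
  show ?thesis
  proof (rule that[of D])
    show "finite (D m)" for m by (simp add: D_def)
    show "incseq D" by (auto simp: incseq_def D_def)
    show "D 0 \<noteq> {}" by (simp add: D_def)
    show "D 0 \<subseteq> T" using UN D'(2) by blast
  qed (rule eq)
qed

section \<open>The alternating sum of the weights\<close>

lemma lambda12_nonneg:
  fixes \<Sigma> :: "real^'m^'m"
  assumes Sigma: "pos_def \<Sigma>" and T: "T \<noteq> {}"
  shows "lambda12 \<Sigma> (nonneg_poly_cone e T) c \<ge> 0"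
proof -
  obtain A :: "real^'m index \<Rightarrow> real^'m" where A: "linear A" "bij A"
    and iso: "\<And>z. qnorm (matrix_inv \<Sigma>) (A z) = norm z"
    using ex_quadratic_isometry[OF pos_def_matrix_inv[OF Sigma] card_UNIV_index] by blast
  have "closed_convex_cone {z. A z \<in> nonneg_poly_cone e T}"
    by (rule nonneg_poly_cone_preimage[OF A(1) T, of e]) (simp only: closed_convex_cone_halfspaces)
  moreover obtain z where "c = A z" using A(2) by (metis bij_pointE)
  ultimately show ?thesis by (simp add: lambda12_isometry[OF A iso])
qed

text \<open>The polynomial with coefficients \<open>w i\<close> and exponents \<open>d i\<close> has
  degree at most \<open>CARD('m)\<close>, so \<open>CARD('m) + 1\<close> nodes determine its value
  at -1. At these nodes it is a constant times Gaussian integrals whose Lagrange combination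
  vanishes.\<close>

lemma alternating_weight_sum_eq_0:
  fixes \<Sigma> :: "real^'m^'m"
  assumes T: "T \<noteq> {}" and e: "e i0 = 0"
    and Sigma: "pos_def \<Sigma>" and M: "prob_space M"
    and X: "distributed M lborel X (\<lambda>c. ennreal (mvn_density 0 \<Sigma> c))"
    and w: "(\<Sum>i\<in>I. w i) = 1" and d: "\<And>i. i \<in> I \<Longrightarrow> d i \<le> CARD('m)"
    and tail: "\<And>y. \<P>(\<omega> in M. lambda12 \<Sigma> (nonneg_poly_cone e T) (X \<omega>) \<ge> y)
      = (\<Sum>i\<in>I. w i * chi_square_upper (d i) y)"
  shows "(\<Sum>i\<in>I. w i * (-1) ^ d i) = 0"
proof -
  interpret M: prob_space M by (rule M)
  define K where "K = nonneg_poly_cone e T"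
  obtain A :: "real^'m index \<Rightarrow> real^'m" where A: "linear A" "bij A"
    and iso: "\<And>z. qnorm (matrix_inv \<Sigma>) (A z) = norm z"
    using ex_quadratic_isometry[OF pos_def_matrix_inv[OF Sigma] card_UNIV_index] by blast
  obtain D where D: "\<And>m. finite (D m)" "incseq D" "D 0 \<noteq> {}" "D 0 \<subseteq> T"
    and preimage: "{z. A z \<in> K} = {z. \<forall>a\<in>(\<Union>m. (\<lambda>t. adjoint A (monomial_vec e t)) ` D m). a \<bullet> z \<ge> 0}"
    by (rule nonneg_poly_cone_preimage[OF A(1) T, of e, folded K_def]) (rule that)
  have ccc: "closed_convex_cone {z. A z \<in> K}"
    unfolding preimage by (rule closed_convex_cone_halfspaces)
  interpret closed_convex_cone "{z. A z \<in> K}" by (rule ccc)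
  have lambda12: "lambda12 \<Sigma> K (A z) = (norm (z - proj z))\<^sup>2" for z
    by (rule lambda12_isometry[OF A iso ccc])
  obtain C :: real where C: "C > 0" and transfer: "\<And>g. g \<in> borel_measurable borel \<Longrightarrow>
      (\<integral>\<^sup>+\<omega>. g (X \<omega>) \<partial>M) = ennreal C * (\<integral>\<^sup>+z. ennreal (exp (- (norm z)\<^sup>2 / 2)) * g (A z) \<partial>lborel)"
    using mvn_nn_integral_isometry[OF A iso Sigma card_UNIV_index M X] by blast
  \<comment> \<open>Finiteness of the Gaussian integral follows from the total mass 1 of the law of
    \<open>X\<close>.\<close>
  have gauss: "integrable lborel (\<lambda>z::real^'m index. exp (- (norm z)\<^sup>2 / 2))"
  proof (rule integrableI_nonneg)
    have "ennreal C * (\<integral>\<^sup>+z. ennreal (exp (- (norm z)\<^sup>2 / 2)) \<partial>(lborel :: (real^'m index) measure)) = 1"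
      using transfer[of "\<lambda>_. 1"] M.emeasure_space_1 by simp
    then have "(\<integral>\<^sup>+z. ennreal (exp (- (norm z)\<^sup>2 / 2)) \<partial>(lborel :: (real^'m index) measure)) \<noteq> \<infinity>"
      using C by (auto simp: ennreal_mult_top)
    then show "(\<integral>\<^sup>+z. ennreal (exp (- (norm z)\<^sup>2 / 2)) \<partial>(lborel :: (real^'m index) measure)) < \<infinity>"
      by (simp add: less_top[symmetric])
  qed auto
  obtain B where "linear B" and BA: "B \<circ> A = id"
    using linear_injective_left_inverse[OF A(1) bij_is_inj[OF A(2)]] by blast
  have AB: "A (B c) = c" for c
  proof -
    obtain z where "c = A z" using A(2) by (metis bij_pointE)
    then show ?thesis using fun_cong[OF BA, of z] by simp
  qed
  from \<open>linear B\<close> have [measurable]: "B \<in> borel_measurable borel"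
    using linear_continuous_on[OF linear_conv_bounded_linear[THEN iffD1]]
    by (intro borel_measurable_continuous_onI) blast
  have [measurable]: "proj \<in> borel_measurable borel"
    by (rule borel_measurable_continuous_onI[OF continuous_on_proj])
  have lambda12_eq: "lambda12 \<Sigma> K c = (norm (B c - proj (B c)))\<^sup>2" for c
    using lambda12[of "B c"] by (simp add: AB)
  have [measurable]: "lambda12 \<Sigma> K \<in> borel_measurable borel"
    unfolding lambda12_eq[abs_def] by measurable
  have [measurable]: "X \<in> measurable M borel" using distributed_measurable[OF X] by simp
  have laplace: "(\<Sum>i\<in>I. w i * t ^ d i) = C * (\<integral>z. gauss_stretch t z \<partial>lborel)" if t: "0 < t" "t < 1" for t
  proof -
    \<comment> \<open>Chosen so that \<open>1 / sqrt (1 + 2 * r) = t\<close>, which turns chi-square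
      Laplace transforms into powers of \<open>t\<close>.\<close>
    define r where "r = (1 / t\<^sup>2 - 1) / 2"
    have "t\<^sup>2 < 1" using t by (simp add: power_less_one_iff abs_square_less_1)
    then have r: "r > 0" using t by (simp add: r_def)
    have "1 + 2 * r = 1 / t\<^sup>2" unfolding r_def by argo
    then have rt: "1 / sqrt (1 + 2 * r) = t" using t by (simp add: real_sqrt_divide)
    have pointwise: "exp (- (norm z)\<^sup>2 / 2) * exp (- r * (norm (z - proj z))\<^sup>2) = gauss_stretch t z" for z
    proof -
      have "(norm z)\<^sup>2 / 2 + r * (norm (z - proj z))\<^sup>2 = (norm (stretch (1 / t) z))\<^sup>2 / 2"
        unfolding norm_stretch pythagoras[of z]
        by (simp add: r_def power_divide algebra_simps add_divide_distrib diff_divide_distrib)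
      then show ?thesis by (simp add: gauss_stretch_def flip: exp_add)
    qed
    have "(\<Sum>i\<in>I. w i * t ^ d i) = (\<integral>\<omega>. exp (- r * lambda12 \<Sigma> K (X \<omega>)) \<partial>M)"
      by (subst M.laplace_chi_square_mixture[OF _ _ r w, where d = d])
        (use tail in \<open>auto simp: rt lambda12_eq K_def[symmetric]\<close>)
    also have "\<dots> = enn2real (\<integral>\<^sup>+\<omega>. ennreal (exp (- r * lambda12 \<Sigma> K (X \<omega>))) \<partial>M)"
      by (rule integral_eq_nn_integral) auto
    also have "(\<integral>\<^sup>+\<omega>. ennreal (exp (- r * lambda12 \<Sigma> K (X \<omega>))) \<partial>M)
        = ennreal C * (\<integral>\<^sup>+z. ennreal (gauss_stretch t z) \<partial>lborel)"
      by (subst transfer[of "\<lambda>c. ennreal (exp (- r * lambda12 \<Sigma> K c))"])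
        (auto simp: lambda12 simp flip: pointwise ennreal_mult)
    also have "enn2real \<dots> = C * (\<integral>z. gauss_stretch t z \<partial>lborel)"
      using C by (subst integral_eq_nn_integral) (auto simp: enn2real_mult gauss_stretch_def)
    finally show ?thesis .
  qed
  obtain S where S: "finite S" "card S = CARD('m) + 1" "S \<subseteq> {0<..<1 :: real}"
    using ex_finite_near_1[of 0] by auto
  \<comment> \<open>The constant polynomial 1 in the coordinates \<open>z\<close>; its pairing with
    every \<open>monomial_vec e t\<close> is 1, so its negative violates every constraint.\<close>
  define k where "k = B (axis i0 1)"
  obtain t0 where t0: "t0 \<in> D 0" using D(3) by blast
  have one: "axis i0 1 \<bullet> monomial_vec e t = 1" for t
    using e by (simp add: monomial_vec_def inner_axis')
  have "(\<Sum>t\<in>S. lagrange_weight S t * (\<integral>z. gauss_stretch t z \<partial>lborel)) = 0"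
  proof (rule sum_lagrange_gauss_stretch[OF _ _ preimage])
    show "finite ((\<lambda>t. adjoint A (monomial_vec e t)) ` D m)" for m using D(1) by simp
    show "incseq (\<lambda>m. (\<lambda>t. adjoint A (monomial_vec e t)) ` D m)"
      using D(2) by (auto simp: incseq_def intro!: image_mono)
    show "k \<in> {z. A z \<in> K}" by (simp add: k_def AB K_def nonneg_poly_cone_def one)
    show "adjoint A (monomial_vec e t0) \<in> (\<lambda>t. adjoint A (monomial_vec e t)) ` D 0" using t0 by blast
    have "k \<bullet> adjoint A (monomial_vec e t0) = 1"
      by (simp only: adjoint_works[OF A(1)] k_def AB one)
    then show "adjoint A (monomial_vec e t0) \<bullet> k > 0" by (simp add: inner_commute)
    show "CARD('m index) < card S" using S(2) by (simp add: card_UNIV_index)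
    show "S \<subseteq> {0<..1}" using S(3) by auto
  qed (use S(1) gauss in auto)
  then have "0 = (\<Sum>t\<in>S. lagrange_weight S t * (C * (\<integral>z. gauss_stretch t z \<partial>lborel)))"
    by (simp add: mult.left_commute[of _ C] flip: sum_distrib_left)
  also have "\<dots> = (\<Sum>t\<in>S. lagrange_weight S t * (\<Sum>i\<in>I. w i * t ^ d i))"
    using S(3) by (intro sum.cong refl) (auto simp: laplace)
  also have "\<dots> = (\<Sum>i\<in>I. w i * (\<Sum>t\<in>S. lagrange_weight S t * t ^ d i))"
    unfolding sum_distrib_left by (subst sum.swap) (simp add: mult.left_commute)
  also have "\<dots> = (\<Sum>i\<in>I. w i * (-1) ^ d i)"
  proof (intro sum.cong refl)
    fix i assume i: "i \<in> I"
    have "degree (monom (1 :: real) (d i)) < card S"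
      using d[OF i] S(2) by (simp add: degree_monom_eq)
    from poly_minus_1_lagrange[OF S(1) this]
    show "w i * (\<Sum>t\<in>S. lagrange_weight S t * t ^ d i) = w i * (-1) ^ d i"
      by (simp add: poly_monom)
  qed
  finally show ?thesis by simp
qed

section \<open>Shifting weights within parity classes\<close>

lemma sum_nth_append3:
  fixes G :: "nat \<Rightarrow> real"
  assumes "length xs = p" "length ys = q" "length zs = r"
  shows "(\<Sum>i<p + (q + r). (xs @ ys @ zs) ! i * G i)
    = (\<Sum>i<p. xs ! i * G i) + (\<Sum>i<q. ys ! i * G (p + i)) + (\<Sum>i<r. zs ! i * G (p + (q + i)))"
proof -
  have split: "(\<Sum>i<m + l. f i) = (\<Sum>i<m. f i) + (\<Sum>i<l. f (m + i))" for f :: "nat \<Rightarrow> real" and m l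
    by (induction l) auto
  show ?thesis unfolding split using assms by (simp add: nth_append)
qed

lemma sum_split_ends:
  fixes f :: "nat \<Rightarrow> real"
  assumes "n > 4"
  shows "(\<Sum>i=0..n + 1. f i) = f 0 + f 1 + (\<Sum>i=2..n - 1. f i) + f n + f (n + 1)"
proof -
  obtain m where m: "n = Suc (Suc (Suc m))" using assms by (metis Suc_eq_plus1 add_2_eq_Suc' less_iff_Suc_add numeral_eq_Suc pred_numeral_simps(2) add_Suc)
  show ?thesis
    by (simp add: m sum.atLeast_Suc_atMost[of 0] sum.atLeast_Suc_atMost[of "Suc 0"] numeral_2_eq_2)
qed

lemma sum_u_weights:
  assumes "n > 4"
  shows "(\<Sum>i=0..n + 1. u_weights n w ! i * G i) = w 0 * G 0 + w 1 * G 1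
    + (1/2 - w 0 - (if odd n then w (n + 1) else w n)) * G 2
    + (1/2 - w 1 - (if odd n then w n else w (n + 1))) * G 3 + w n * G n + w (n + 1) * G (n + 1)"
proof -
  have sum4: "(\<Sum>i<4. [a, b, c, d] ! i * H i) = a * H 0 + b * H 1 + c * H 2 + d * H 3"
    for a b c d :: real and H :: "nat \<Rightarrow> real" by (simp add: numeral_eq_Suc)
  have sum2: "(\<Sum>i<2. [a, b] ! i * H i) = a * H 0 + b * H 1"
    for a b :: real and H :: "nat \<Rightarrow> real" by (simp add: numeral_eq_Suc)
  have "(\<Sum>i=0..n + 1. ([a, b, c, d] @ replicate (n - 4) 0 @ [w n, w (n + 1)]) ! i * G i)
      = a * G 0 + b * G 1 + c * G 2 + d * G 3 + w n * G n + w (n + 1) * G (n + 1)" for a b c d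
  proof -
    have "{0..n + 1} = {..<4 + ((n - 4) + 2)}" using assms by auto
    then have "(\<Sum>i=0..n + 1. ([a, b, c, d] @ replicate (n - 4) 0 @ [w n, w (n + 1)]) ! i * G i)
      = (\<Sum>i<4. [a, b, c, d] ! i * G i) + (\<Sum>i<n - 4. replicate (n - 4) 0 ! i * G (4 + i))
        + (\<Sum>i<2. [w n, w (n + 1)] ! i * G (4 + (n - 4 + i)))"
      by (simp only:) (rule sum_nth_append3; simp)
    also have "(\<Sum>i<n - 4. replicate (n - 4) 0 ! i * G (4 + i)) = 0"
      by (intro sum.neutral) simp
    finally show ?thesis unfolding sum4 sum2 using assms by simp
  qed
  then show ?thesis by (simp add: u_weights_def)
qed

lemma sum_v_weights:
  assumes "n > 4"
  shows "(\<Sum>i=0..n + 1. v_weights n w ! i * G i) = w 0 * G 0 + w 1 * G 1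
    + (if odd n then (1/2 - w 1 - w n) * G (n - 2) + (1/2 - w 0 - w (n + 1)) * G (n - 1)
       else (1/2 - w 0 - w n) * G (n - 2) + (1/2 - w 1 - w (n + 1)) * G (n - 1))
    + w n * G n + w (n + 1) * G (n + 1)"
proof -
  have sum4: "(\<Sum>i<4. [a, b, c, d] ! i * H i) = a * H 0 + b * H 1 + c * H 2 + d * H 3"
    for a b c d :: real and H :: "nat \<Rightarrow> real" by (simp add: numeral_eq_Suc)
  have sum2: "(\<Sum>i<2. [a, b] ! i * H i) = a * H 0 + b * H 1"
    for a b :: real and H :: "nat \<Rightarrow> real" by (simp add: numeral_eq_Suc)
  have "(\<Sum>i=0..n + 1. ([w 0, w 1] @ replicate (n - 4) 0 @ [a, b, c, d]) ! i * G i)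
      = w 0 * G 0 + w 1 * G 1 + a * G (n - 2) + b * G (n - 1) + c * G n + d * G (n + 1)" for a b c d
  proof -
    have "{0..n + 1} = {..<2 + ((n - 4) + 4)}" using assms by auto
    then have "(\<Sum>i=0..n + 1. ([w 0, w 1] @ replicate (n - 4) 0 @ [a, b, c, d]) ! i * G i)
      = (\<Sum>i<2. [w 0, w 1] ! i * G i) + (\<Sum>i<n - 4. replicate (n - 4) 0 ! i * G (2 + i))
        + (\<Sum>i<4. [a, b, c, d] ! i * G (2 + (n - 4 + i)))"
      by (simp only:) (rule sum_nth_append3; simp)
    also have "(\<Sum>i<n - 4. replicate (n - 4) 0 ! i * G (2 + i)) = 0"
      by (intro sum.neutral) simp
    moreover have "2 + (n - 4 + 0) = n - 2" "2 + (n - 4 + 1) = n - 1" "2 + (n - 4 + 2) = n"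
      "2 + (n - 4 + 3) = n + 1" using assms by auto
    ultimately show ?thesis unfolding sum4 sum2 by simp
  qed
  then show ?thesis by (simp add: v_weights_def)
qed

text \<open>Total mass 1 and vanishing alternating sum give each parity class mass 1/2, so the
  differences in \<open>u_weights\<close> and \<open>v_weights\<close> are the even and odd middle
  masses \<open>E\<close> and \<open>O'\<close>. Each is moved to the lowest or highest middle index
  of its parity.\<close>

lemma weighted_sum_bounds:
  assumes n: "n > 4" and w_nonneg: "\<And>i. i \<le> n + 1 \<Longrightarrow> w i \<ge> 0" and w_sum: "(\<Sum>i=0..n + 1. w i) = 1"
    and alt: "(\<Sum>i=0..n + 1. w i * (-1) ^ (n + 1 - i)) = 0"
    and mono: "\<And>i j. i \<le> j \<Longrightarrow> j \<le> n + 1 \<Longrightarrow> G i \<le> (G j :: real)"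
  shows "(\<Sum>i=0..n + 1. u_weights n w ! i * G i) \<le> (\<Sum>i=0..n + 1. w i * G i)"
    and "(\<Sum>i=0..n + 1. w i * G i) \<le> (\<Sum>i=0..n + 1. v_weights n w ! i * G i)"
proof -
  define E where "E = (\<Sum>i=2..n - 1. if even i then w i else 0)"
  define O' where "O' = (\<Sum>i=2..n - 1. if even i then 0 else w i)"
  have mid: "w 0 + w 1 + (E + O') + w n + w (n + 1) = 1"
  proof -
    have "(\<Sum>i=2..n - 1. w i) = E + O'"
      unfolding E_def O'_def by (simp flip: sum.distrib) (intro sum.cong refl, simp)
    then show ?thesis using w_sum sum_split_ends[OF n, of w] by simp
  qed
  have sgn: "(-1) ^ (n + 1 - i) = (if even i = odd n then 1 else - 1 :: real)" if "i \<le> n + 1" for i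
    using that by (auto simp: minus_one_power_iff)
  have "(\<Sum>i=0..n + 1. w i * (if even i = odd n then 1 else - 1)) = 0"
    unfolding alt[symmetric] by (intro sum.cong refl) (simp add: sgn)
  moreover have "(\<Sum>i=2..n - 1. w i * (if even i = odd n then 1 else - 1)) = (if odd n then E - O' else O' - E)"
    unfolding E_def O'_def by (auto simp flip: sum_subtractf intro!: sum.cong)
  ultimately have alt': "if odd n then w 0 - w 1 + (E - O') - w n + w (n + 1) = 0
      else - w 0 + w 1 + (O' - E) - w n + w (n + 1) = 0"
    unfolding sum_split_ends[OF n, of "\<lambda>i. w i * (if even i = odd n then 1 else - 1)"]
    by (auto split: if_splits)
  have EO: "1/2 - w 0 - (if odd n then w (n + 1) else w n) = E"
    "1/2 - w 1 - (if odd n then w n else w (n + 1)) = O'"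
    using mid alt' by (auto split: if_splits)
  have lower: "E * G 2 + O' * G 3 \<le> (\<Sum>i=2..n - 1. w i * G i)"
    unfolding E_def O'_def sum_distrib_right sum.distrib[symmetric]
  proof (rule sum_mono)
    fix i assume i: "i \<in> {2..n - 1}"
    then have "w i \<ge> 0" "G 2 \<le> G i" using w_nonneg[of i] mono[of 2 i] by auto
    moreover have "G 3 \<le> G i" if "odd i"
    proof -
      have "i \<noteq> 2" using that by auto
      then show ?thesis using mono[of 3 i] i by auto
    qed
    ultimately show "(if even i then w i else 0) * G 2 + (if even i then 0 else w i) * G 3 \<le> w i * G i"
      by (auto intro: mult_left_mono)
  qed
  have upper: "(\<Sum>i=2..n - 1. w i * G i) \<le> (if odd n then O' * G (n - 2) + E * G (n - 1)
      else E * G (n - 2) + O' * G (n - 1))"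
  proof -
    have "(\<Sum>i=2..n - 1. w i * G i) \<le> (\<Sum>i=2..n - 1. (if even i then w i else 0) * G (if odd n then n - 1 else n - 2)
        + (if even i then 0 else w i) * G (if odd n then n - 2 else n - 1))"
    proof (rule sum_mono)
      fix i assume i: "i \<in> {2..n - 1}"
      then have "w i \<ge> 0" using w_nonneg[of i] by auto
      moreover have "G i \<le> G (n - 1)" using mono[of i "n - 1"] i by auto
      \<comment> \<open>The index \<open>n - 1\<close> has the other parity, so such an
        \<open>i\<close> is at most \<open>n - 2\<close>.\<close>
      moreover have "G i \<le> G (n - 2)" if "even i = even n"
      proof -
        have "i \<noteq> n - 1" using that n by (cases n) auto
        then show ?thesis using mono[of i "n - 2"] i by auto
      qed
      ultimately show "w i * G i \<le> (if even i then w i else 0) * G (if odd n then n - 1 else n - 2)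
        + (if even i then 0 else w i) * G (if odd n then n - 2 else n - 1)"
        by (auto intro: mult_left_mono)
    qed
    also have "\<dots> = E * G (if odd n then n - 1 else n - 2) + O' * G (if odd n then n - 2 else n - 1)"
      unfolding E_def O'_def sum.distrib sum_distrib_right ..
    finally show ?thesis by (simp add: add.commute split: if_splits)
  qed
  show "(\<Sum>i=0..n + 1. u_weights n w ! i * G i) \<le> (\<Sum>i=0..n + 1. w i * G i)"
    unfolding sum_u_weights[OF n] EO sum_split_ends[OF n, of "\<lambda>i. w i * G i"] using lower by simp
  show "(\<Sum>i=0..n + 1. w i * G i) \<le> (\<Sum>i=0..n + 1. v_weights n w ! i * G i)"
    unfolding sum_v_weights[OF n] sum_split_ends[OF n, of "\<lambda>i. w i * G i"]
    using upper EO by (auto split: if_splits)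
qed

section \<open>Bounds for the two marginal tails\<close>

theorem mainTheorem5:
  fixes n :: nat
    and T :: "real set"
    and e :: "'m::finite \<Rightarrow> nat"
    and \<Sigma> :: "real ^ 'm ^ 'm"
    and M :: "'a measure"
    and c_hat :: "'a \<Rightarrow> real ^ 'm"
    and w :: "nat \<Rightarrow> real"
  defines "K \<equiv> nonneg_poly_cone e T"
  assumes n: "n > 4"
    and T: "(\<exists>a b. a < b \<and> T = {a..b}) \<or> (\<exists>a. T = {a..}) \<or> (T = UNIV \<and> even n)"
    and e: "bij_betw e UNIV {0..n}"
    and Sigma: "pos_def \<Sigma>"
    and M: "prob_space M"
    and c_hat: "distributed M lborel c_hat (\<lambda>c. ennreal (mvn_density 0 \<Sigma> c))"
    and w_nonneg: "\<And>i. i \<le> n + 1 \<Longrightarrow> w i \<ge> 0"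
    and w_sum: "(\<Sum>i=0..n+1. w i) = 1"
    and w_repr: "\<And>x y :: real.
      \<P>(\<omega> in M. lambda01 \<Sigma> K (c_hat \<omega>) \<ge> x \<and> lambda12 \<Sigma> K (c_hat \<omega>) \<ge> y)
        = (\<Sum>i=0..n+1. w i * chi_square_upper i x * chi_square_upper (n + 1 - i) y)"
  shows "\<forall>x::real.
      (\<Sum>i=0..n+1. u_weights n w ! i * chi_square_upper i x)
        \<le> \<P>(\<omega> in M. lambda01 \<Sigma> K (c_hat \<omega>) \<ge> x)
    \<and> \<P>(\<omega> in M. lambda01 \<Sigma> K (c_hat \<omega>) \<ge> x)
        \<le> (\<Sum>i=0..n+1. v_weights n w ! i * chi_square_upper i x)
    \<and> (\<Sum>i=0..n+1. v_weights n w ! i * chi_square_upper (n + 1 - i) x)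
        \<le> \<P>(\<omega> in M. lambda12 \<Sigma> K (c_hat \<omega>) \<ge> x)
    \<and> \<P>(\<omega> in M. lambda12 \<Sigma> K (c_hat \<omega>) \<ge> x)
        \<le> (\<Sum>i=0..n+1. u_weights n w ! i * chi_square_upper (n + 1 - i) x)"
proof
  fix x :: real
  interpret M: prob_space M by (rule M)
  have card: "CARD('m) = n + 1"
    using bij_betw_same_card[OF e] by simp
  obtain i0 where i0: "e i0 = 0"
    using e by (metis atLeastAtMost_iff bij_betw_iff_bijections le0)
  have T_ne: "T \<noteq> {}" using T by auto
  have lambda01: "lambda01 \<Sigma> K c \<ge> 0" for c by (simp add: lambda01_def)
  have lambda12: "lambda12 \<Sigma> K c \<ge> 0" for c
    unfolding K_def by (rule lambda12_nonneg[OF Sigma T_ne])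
  \<comment> \<open>Both statistics are nonnegative and chi-square tails equal 1 at 0, so setting
    the other threshold to 0 gives the marginal tails.\<close>
  have tail01: "\<P>(\<omega> in M. lambda01 \<Sigma> K (c_hat \<omega>) \<ge> x) = (\<Sum>i=0..n+1. w i * chi_square_upper i x)" for x
    using w_repr[of x 0] lambda12 by (simp add: chi_square_upper_nonpos)
  have tail12: "\<P>(\<omega> in M. lambda12 \<Sigma> K (c_hat \<omega>) \<ge> y) = (\<Sum>i=0..n+1. w i * chi_square_upper (n + 1 - i) y)" for y
    using w_repr[of 0 y] lambda01 by (simp add: chi_square_upper_nonpos)
  have alt: "(\<Sum>i=0..n+1. w i * (-1) ^ (n + 1 - i)) = 0"
    by (rule alternating_weight_sum_eq_0[OF T_ne i0 Sigma M c_hat w_sum _ tail12[unfolded K_def]])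
      (simp add: card)
  have bounds01: "(\<Sum>i=0..n+1. u_weights n w ! i * chi_square_upper i x) \<le> (\<Sum>i=0..n+1. w i * chi_square_upper i x)"
    "(\<Sum>i=0..n+1. w i * chi_square_upper i x) \<le> (\<Sum>i=0..n+1. v_weights n w ! i * chi_square_upper i x)"
    using weighted_sum_bounds[OF n w_nonneg w_sum alt, of "\<lambda>i. chi_square_upper i x"]
    by (simp_all add: chi_square_upper_mono)
  \<comment> \<open>The tails with \<open>n + 1 - i\<close> degrees of freedom decrease in
    \<open>i\<close>; applying the bounds to their negatives exchanges the roles of
    \<open>u_weights\<close> and \<open>v_weights\<close>.\<close>
  have mono: "- chi_square_upper (n + 1 - i) x \<le> - chi_square_upper (n + 1 - j) x" if "i \<le> j" for i j
    using that by (simp add: chi_square_upper_mono)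
  have bounds12: "(\<Sum>i=0..n+1. v_weights n w ! i * chi_square_upper (n + 1 - i) x) \<le> (\<Sum>i=0..n+1. w i * chi_square_upper (n + 1 - i) x)"
    "(\<Sum>i=0..n+1. w i * chi_square_upper (n + 1 - i) x) \<le> (\<Sum>i=0..n+1. u_weights n w ! i * chi_square_upper (n + 1 - i) x)"
    using weighted_sum_bounds[OF n w_nonneg w_sum alt, of "\<lambda>i. - chi_square_upper (n + 1 - i) x"] mono
    by (simp_all only: mult_minus_right sum_negf neg_le_iff_le)
  show "(\<Sum>i=0..n+1. u_weights n w ! i * chi_square_upper i x)
        \<le> \<P>(\<omega> in M. lambda01 \<Sigma> K (c_hat \<omega>) \<ge> x)
    \<and> \<P>(\<omega> in M. lambda01 \<Sigma> K (c_hat \<omega>) \<ge> x)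
        \<le> (\<Sum>i=0..n+1. v_weights n w ! i * chi_square_upper i x)
    \<and> (\<Sum>i=0..n+1. v_weights n w ! i * chi_square_upper (n + 1 - i) x)
        \<le> \<P>(\<omega> in M. lambda12 \<Sigma> K (c_hat \<omega>) \<ge> x)
    \<and> \<P>(\<omega> in M. lambda12 \<Sigma> K (c_hat \<omega>) \<ge> x)
        \<le> (\<Sum>i=0..n+1. u_weights n w ! i * chi_square_upper (n + 1 - i) x)"
    unfolding tail01 tail12 using bounds01 bounds12 by blast
qed

end
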